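(* Assume Assumptions 1 and 3, and fix $T\ge1$. Set $J^T_T\equiv0$ and for $t=T-1,\dots,0$ define $$J^T_t(\pi)=\inf_{Q\in\mathcal Q_c}\Big(\tfrac1T c(\pi,Q)+\sum_{m=1}^M J^T_{t+1}\big(\hat\pi(m,\pi,Q)\big)\,\pi(Q^{-1}(m))\Big)$$ (terms with $\pi(Q^{-1}(m))=0$ being zero). Then for $t\ge1$ and $\pi\in\mathcal S$, and for $t=0$ and $\pi\in\mathcal S\cup\{\pi_0\}$, the infimum is attained by some $Q\in\mathcal Q_c$. Moreover, $J^T_t$ is continuous on $\mathcal S$ in the following sense: if $\pi_n\to\pi$ in $\mathcal S$ and $\lim_{L\to\infty}\sup_{n\ge1}\int_{\{\|x\|^2\ge L\}}\|x\|^2\pi_n(dx)=0$, then $J^T_t(\pi_n)\to J^T_t(\pi)$.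
   Context: Assumption 1: the source is $x_{t+1}=f(x_t,w_t)$ with $f:\mathbb R^d\times\mathbb R^d\to\mathbb R^d$ Borel, $\{w_t\}$ i.i.d. and independent of $x_0\sim\pi_0$; for each $x$ the law of $f(x,w_0)$ has a density $\phi(\cdot|x)$ which is strictly positive everywhere, bounded by $C$ and $C_1$-Lipschitz, uniformly in $x$. Assumption 3: (i) $\|f(x,w)\|\le K(\|x\|+\|w\|)$ for some $K>0$ and all $x,w$; (ii) $\mathbb U=\mathbb R^d$ and $c_0(x,u)=\|x-u\|^2$; (iii) the law $\nu_w$ of $w_t$ has $\int\|z\|^2\nu_w(dz)<\infty$; (iv) $\pi_0$ admits a density with $\int\|x\|^2\pi_0(dx)<\infty$, or $\pi_0=\delta_{x_0}$ is a point mass. $\mathcal S$: probability measures on $\mathbb R^d$ with density bounded by $C$ and $C_1$-Lipschitz (weak topology). $\mathcal Q_c$: Borel maps $Q:\mathbb R^d\to\{1,\dots,M\}$ with all cells convex, topologized by: fix $P$ with strictly positive density, identify $Q,Q'$ if $PQ=PQ'$, and $Q_n\to Q$ iff $PQ_n\to PQ$ weakly, where $PQ(A\times\{i\})=P(A\cap Q^{-1}(i))$. Cost $c(\pi,Q)=\sum_{i=1}^M\inf_{u\in\mathbb R^d}\int_{Q^{-1}(i)}\|x-u\|^2\pi(dx)$. $\hat\pi(m,\pi,Q)$ is the probability measure with density $z\mapsto\pi(Q^{-1}(m))^{-1}\int_{Q^{-1}(m)}\phi(z|x)\pi(dx)$. *)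

theory Defs
  imports "HOL-Probability.Probability"
begin

definition in_S :: "real \<Rightarrow> real \<Rightarrow> 'a::euclidean_space measure \<Rightarrow> bool" where
  "in_S C C1 \<mu> \<longleftrightarrow> prob_space \<mu> \<and>
     (\<exists>g :: 'a \<Rightarrow> real. \<mu> = density lborel (\<lambda>x. ennreal (g x)) \<and>
        (\<forall>x. 0 \<le> g x \<and> g x \<le> C) \<and> C1-lipschitz_on UNIV g)"

definition weakly_converges :: "(nat \<Rightarrow> 'a::euclidean_space measure) \<Rightarrow> 'a measure \<Rightarrow> bool" where
  "weakly_converges \<mu>s \<mu> \<longleftrightarrow>
     (\<forall>h :: 'a \<Rightarrow> real. continuous_on UNIV h \<and> bounded (range h) \<longrightarrow>
        (\<lambda>n. \<integral>x. h x \<partial>(\<mu>s n)) \<longlonglongrightarrow> (\<integral>x. h x \<partial>\<mu>))"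

definition Qc :: "nat \<Rightarrow> ('a::euclidean_space \<Rightarrow> nat) set" where
  "Qc M = {Q. Q \<in> borel \<rightarrow>\<^sub>M count_space UNIV \<and> range Q \<subseteq> {1..M} \<and>
              (\<forall>i. convex (Q -` {i}))}"

definition qcost :: "nat \<Rightarrow> 'a::euclidean_space measure \<Rightarrow> ('a \<Rightarrow> nat) \<Rightarrow> ennreal" where
  "qcost M \<pi> Q = (\<Sum>i=1..M. INF u. \<integral>\<^sup>+ x. indicator (Q -` {i}) x * ennreal ((norm (x - u))\<^sup>2) \<partial>\<pi>)"

text \<open>The updated measure pi-hat(m,pi,Q); phi x z stands for phi(z|x).\<close>
definition post :: "('a::euclidean_space \<Rightarrow> 'a \<Rightarrow> real) \<Rightarrow> nat \<Rightarrow> 'a measure \<Rightarrow> ('a \<Rightarrow> nat) \<Rightarrow> 'a measure" where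
  "post phi m \<pi> Q = density lborel
     (\<lambda>z. (\<integral>\<^sup>+ x. indicator (Q -` {m}) x * ennreal (phi x z) \<partial>\<pi>) / emeasure \<pi> (Q -` {m}))"

text \<open>The objective inside the infimum, given the next value function J.
  Terms with pi(Q^{-1}(m)) = 0 vanish since 0 * x = 0 in ennreal.\<close>
definition objective :: "nat \<Rightarrow> nat \<Rightarrow> ('a::euclidean_space \<Rightarrow> 'a \<Rightarrow> real) \<Rightarrow> ('a measure \<Rightarrow> ennreal)
    \<Rightarrow> 'a measure \<Rightarrow> ('a \<Rightarrow> nat) \<Rightarrow> ennreal" where
  "objective T M phi J \<pi> Q =
     qcost M \<pi> Q / of_nat T + (\<Sum>m=1..M. J (post phi m \<pi> Q) * emeasure \<pi> (Q -` {m}))"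

text \<open>Jaux T M phi k = J^T_{T-k} (k = number of remaining steps).\<close>
primrec Jaux :: "nat \<Rightarrow> nat \<Rightarrow> ('a::euclidean_space \<Rightarrow> 'a \<Rightarrow> real) \<Rightarrow> nat \<Rightarrow> 'a measure \<Rightarrow> ennreal" where
  "Jaux T M phi 0 \<pi> = 0"
| "Jaux T M phi (Suc k) \<pi> = (INF Q\<in>Qc M. objective T M phi (Jaux T M phi k) \<pi> Q)"

definition JT :: "nat \<Rightarrow> nat \<Rightarrow> ('a::euclidean_space \<Rightarrow> 'a \<Rightarrow> real) \<Rightarrow> nat \<Rightarrow> 'a measure \<Rightarrow> ennreal" where
  "JT T M phi t = Jaux T M phi (T - t)"

end

theory Submission
  imports Defs
begin

text \<open>
  Two facts drive the proof. First, the set of convex quantizers is sequentially compact for almost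
  everywhere convergence: along a diagonal subsequence \<open>Q\<^sub>n\<close> converges on a countable dense set; the
  sets \<open>B\<^sub>i\<close> of points where \<open>Q\<^sub>n\<close> is eventually \<open>i\<close> are disjoint and convex and their closures cover the
  space, so (frontiers of convex sets being null) they cover almost everything, and separating
  hyperplanes extend them to a Borel partition into convex cells. Secondly, if densities converge
  almost everywhere together with their second moments, then by Scheffe's lemma all integrals of
  functions of quadratic growth over converging cells converge. Hence costs, cell probabilities and
  the densities and second moments of the updated measures all converge, and by induction the
  objective is jointly continuous in the measure and the quantizer. Cells of vanishing probability
  are harmless because the value functions are bounded by a multiple of \<open>1 + \<integral>|x|\<^sup>2\<close>. For
  uniformly Lipschitz densities, weak convergence implies pointwise convergence: test against
  shrinking bumps.
\<close>

section \<open>Compactness of convex quantizers\<close>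

text \<open>The obstacle is that the transition density \<open>phi x z\<close> depends on the state
  \<open>x\<close> only measurably, so weak convergence of measures does not by itself pass through
  an update. Densities remove it: once \<open>weight x * gs n x\<close> converges in L1, the
  densities may be integrated against any measurable function dominated by \<open>weight\<close>,
  continuous or not, and for fixed \<open>z\<close> the function \<open>phi x z\<close> of
  \<open>x\<close> is of this kind. This mode of convergence survives the update, because the second
  moment of an updated measure is again an integral over a cell, namely of the expected weight of
  the next state. Two kinds of measures lie outside this argument: a density in \<open>in_S\<close>
  may have infinite second moment, and \<open>pi0\<close> may be a point mass. In both cases the
  objective takes the same value at all quantizers, so any of them attains the infimum. Continuity
  of the infimum has two halves: a minimizer for the limit measure controls the values from above,
  and an almost everywhere limit of minimizers along a subsequence controls them from below.\<close>

lemma diagonal_finite_range: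
  fixes F :: "nat \<Rightarrow> nat \<Rightarrow> nat"
  assumes "\<And>n q. F n q \<in> {1..M}"
  obtains r l where "strict_mono r" "\<And>q. eventually (\<lambda>n. F (r n) q = l q) sequentially"
proof -
  interpret subseqs "\<lambda>q s. \<exists>i. \<forall>n. F (s n) q = i"
  proof
    fix q and s :: "nat \<Rightarrow> nat"
    have "finite (range (\<lambda>n. F (s n) q))"
      by (rule finite_subset[of _ "{1..M}"]) (use assms in auto)
    then obtain k where "infinite {n \<in> UNIV. F (s n) q = F (s k) q}"
      using pigeonhole_infinite[of UNIV "\<lambda>n. F (s n) q"] infinite_UNIV_nat by (metis UNIV_I)
    from infinite_enumerate[OF this] obtain r' :: "nat \<Rightarrow> nat"
      where r': "strict_mono r'" "\<And>n. F (s (r' n)) q = F (s k) q" by blast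
    show "\<exists>r'::nat \<Rightarrow> nat. strict_mono r' \<and> (\<exists>i. \<forall>n. F ((s \<circ> r') n) q = i)"
    proof (intro exI conjI allI)
      show "strict_mono r'" by (fact r')
      show "F ((s \<circ> r') n) q = F (s k) q" for n using r'(2) by simp
    qed
  qed
  have "\<exists>i. eventually (\<lambda>n. F (diagseq n) q = i) sequentially" for q
  proof -
    \<comment> \<open>Only from index \<open>Suc q\<close> on is the diagonal sequence a subsequence
      of the one chosen for \<open>q\<close>; hence the shift, and constancy merely
      eventually.\<close>
    have "\<exists>i. \<forall>n. F ((diagseq \<circ> (+) (Suc q)) n) q = i"
      by (rule diagseq_holds) auto
    then obtain i where i: "\<And>n. F (diagseq (Suc q + n)) q = i" by auto
    have "F (diagseq n) q = i" if "n \<ge> Suc q" for n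
      using i[of "n - Suc q"] that by simp
    then show ?thesis by (auto simp: eventually_sequentially)
  qed
  then have "\<forall>q. \<exists>i. eventually (\<lambda>n. F (diagseq n) q = i) sequentially" by blast
  from choice[OF this] obtain l where "\<forall>q. eventually (\<lambda>n. F (diagseq n) q = l q) sequentially" ..
  then show ?thesis by (intro that[OF subseq_diagseq]) blast
qed

section \<open>Extending disjoint convex sets to a convex Borel partition\<close>

lemma exists_nonorthogonal:
  fixes A :: "'a::euclidean_space set"
  assumes "finite A" "0 \<notin> A"
  obtains v where "\<And>a. a \<in> A \<Longrightarrow> a \<bullet> v \<noteq> 0"
proof -
  \<comment> \<open>Finitely many hyperplanes form a Lebesgue null set, so they cannot fill the
    space.\<close>
  have "negligible (\<Union>a\<in>A. {v. a \<bullet> v = 0})"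
    using assms by (intro negligible_Union) (auto intro!: negligible_hyperplane)
  then have "(\<Union>a\<in>A. {v. a \<bullet> v = 0}) \<noteq> UNIV"
    by (metis non_negligible_UNIV)
  then show ?thesis using that by blast
qed

text \<open>Ties on the separating hyperplanes are broken by moving an infinitesimal
  step in a direction \<open>v\<close> that is parallel to none of them.\<close>

lemma convex_borel_partition:
  fixes B :: "nat \<Rightarrow> 'a::euclidean_space set"
  assumes conv: "\<And>i. convex (B i)"
    and disj: "\<And>i j. i \<noteq> j \<Longrightarrow> B i \<inter> B j = {}"
    and cover: "(\<Union>i\<in>{1..M}. closure (B i)) = UNIV"
  obtains Q where "Q \<in> Qc M" "\<And>i x. i \<in> {1..M} \<Longrightarrow> x \<in> interior (B i) \<Longrightarrow> Q x = i"
proof -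
  \<comment> \<open>Labels with empty \<open>B i\<close> are dropped, since hyperplane separation
    requires nonempty sets; their cells will be empty.\<close>
  define I where "I = {i\<in>{1..M}. B i \<noteq> {}}"
  have finI: "finite I" by (auto simp: I_def)
  have "\<exists>a b. a \<noteq> 0 \<and> (\<forall>x\<in>B i. a \<bullet> x \<le> b) \<and> (\<forall>x\<in>B j. a \<bullet> x \<ge> b)"
    if "i \<in> I" "j \<in> I" "i < j" for i j
    using separating_hyperplane_sets[OF conv conv _ _ disj] that by (auto simp: I_def)
  then obtain a0 b0 where ab0: "\<And>i j. i \<in> I \<Longrightarrow> j \<in> I \<Longrightarrow> i < j \<Longrightarrow>
      a0 i j \<noteq> 0 \<and> (\<forall>x\<in>B i. a0 i j \<bullet> x \<le> b0 i j) \<and> (\<forall>x\<in>B j. a0 i j \<bullet> x \<ge> b0 i j)"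
    by metis
  define a where "a i j = (if i < j then a0 i j else - a0 j i)" for i j
  define b where "b i j = (if i < j then b0 i j else - b0 j i)" for i j
  have a_ne: "a i j \<noteq> 0" and a_le: "\<And>x. x \<in> B i \<Longrightarrow> a i j \<bullet> x \<le> b i j"
    if "i \<in> I" "j \<in> I" "i \<noteq> j" for i j
    using ab0[of i j] ab0[of j i] that by (auto simp: a_def b_def not_less)
  have swap: "a j i = - a i j" "b j i = - b i j" if "i \<noteq> j" for i j
    using that by (auto simp: a_def b_def)
  obtain v where v: "\<And>i j. i \<in> I \<Longrightarrow> j \<in> I \<Longrightarrow> i \<noteq> j \<Longrightarrow> a i j \<bullet> v \<noteq> 0"
  proof -
    let ?A = "(\<lambda>(i,j). a i j) ` {(i,j). i \<in> I \<and> j \<in> I \<and> i \<noteq> j}"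
    have "finite ?A" by (rule finite_imageI, rule finite_subset[of _ "I \<times> I"]) (use finI in auto)
    moreover have "0 \<notin> ?A" using a_ne by force
    ultimately obtain v where v: "\<And>c. c \<in> ?A \<Longrightarrow> c \<bullet> v \<noteq> 0"
      using exists_nonorthogonal[of ?A] by blast
    show ?thesis by (rule that, rule v) auto
  qed
  \<comment> \<open>If \<open>a i j \<bullet> v < 0\<close>, a step along \<open>v\<close> from the
    hyperplane enters the open side of \<open>B i\<close>, so the hyperplane itself goes to
    \<open>G i j\<close>. The sign change in \<open>swap\<close> makes the opposite choice for
    \<open>G j i\<close>, so the two half-spaces are disjoint.\<close>
  define G where "G i j = (if a i j \<bullet> v < 0 then {x. a i j \<bullet> x \<le> b i j} else {x. a i j \<bullet> x < b i j})" for i j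
  have G_conv: "convex (G i j)" and G_meas: "G i j \<in> sets borel" for i j
    by (auto simp: G_def convex_halfspace_le convex_halfspace_lt intro: closed_halfspace_le open_halfspace_lt)
  have G_disj: "x \<notin> G j i" if "i \<in> I" "j \<in> I" "i \<noteq> j" "x \<in> G i j" for i j x
    using that v[of i j] swap[of i j] by (auto simp: G_def split: if_splits)
  define E where "E i = (\<Inter>j\<in>I-{i}. G i j)" for i
  \<comment> \<open>The shifted points \<open>x + v / (n + 1)\<close> all lie in closures of the
    sets \<open>B k\<close>. One index \<open>i\<close> occurs for infinitely many of them, and
    \<open>x\<close> belongs to its cell.\<close>
  have E_ex: "\<exists>i\<in>I. x \<in> E i" for x
  proof -
    have "\<exists>k\<in>I. x + (1 / Suc n) *\<^sub>R v \<in> closure (B k)" for n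
    proof -
      obtain k where "k \<in> {1..M}" "x + (1 / Suc n) *\<^sub>R v \<in> closure (B k)"
        using cover by blast
      then show ?thesis by (force simp: I_def)
    qed
    then obtain k where k: "\<And>n. k n \<in> I" "\<And>n. x + (1 / Suc n) *\<^sub>R v \<in> closure (B (k n))"
      by metis
    have "finite (range k)" using k(1) finI by (meson finite_subset image_subsetI)
    then obtain n0 where inf: "infinite {n \<in> UNIV. k n = k n0}"
      using pigeonhole_infinite[of UNIV k] infinite_UNIV_nat by (metis UNIV_I)
    obtain r :: "nat \<Rightarrow> nat" where r: "strict_mono r" "\<And>n. k (r n) = k n0"
      using infinite_enumerate[OF inf] by blast
    define i where "i = k n0"
    have iI: "i \<in> I" using k(1) i_def by simp
    have "x \<in> G i j" if j: "j \<in> I" "j \<noteq> i" for j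
    proof -
      have "closure (B i) \<subseteq> {x. a i j \<bullet> x \<le> b i j}"
        using a_le[of i j] iI j by (intro closure_minimal) (auto simp: closed_halfspace_le)
      then have le: "a i j \<bullet> x + (1 / Suc (r n)) * (a i j \<bullet> v) \<le> b i j" for n
        using k(2)[of "r n"] r(2) by (auto simp: i_def inner_add_right)
      have "(\<lambda>n. 1 / real (Suc (r n))) \<longlonglongrightarrow> 0"
        using LIMSEQ_subseq_LIMSEQ[OF LIMSEQ_Suc[OF lim_1_over_n] r(1)]
        by (auto simp: o_def)
      then have "(\<lambda>n. a i j \<bullet> x + (1 / Suc (r n)) * (a i j \<bullet> v)) \<longlonglongrightarrow> a i j \<bullet> x + 0 * (a i j \<bullet> v)"
        by (intro tendsto_intros)
      then have "a i j \<bullet> x + 0 * (a i j \<bullet> v) \<le> b i j"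
        by (rule LIMSEQ_le_const2) (use le in auto)
      then have 1: "a i j \<bullet> x \<le> b i j" by simp
      \<comment> \<open>Here \<open>v\<close> points strictly out of the half-space, yet one shifted
        point is still in its closure; so \<open>x\<close> itself lies strictly inside.\<close>
      have 2: "a i j \<bullet> x < b i j" if "\<not> a i j \<bullet> v < 0"
      proof -
        have "a i j \<bullet> v > 0" using that v[of i j] iI j by force
        then have "0 < (1 / Suc (r 0)) * (a i j \<bullet> v)" by simp
        then show ?thesis using le[of 0] by linarith
      qed
      show ?thesis using 1 2 by (auto simp: G_def)
    qed
    then show ?thesis using iI by (auto simp: E_def)
  qed
  have E_unique: "i = j" if "i \<in> I" "j \<in> I" "x \<in> E i" "x \<in> E j" for i j x
    using that G_disj[of i j x] by (auto simp: E_def)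
  define Q where "Q x = (THE i. i \<in> I \<and> x \<in> E i)" for x
  have Q: "Q x \<in> I" "x \<in> E (Q x)" for x
  proof -
    have "\<exists>!i. i \<in> I \<and> x \<in> E i" using E_ex E_unique by blast
    from theI'[OF this] show "Q x \<in> I" "x \<in> E (Q x)" by (auto simp: Q_def)
  qed
  have vim: "Q -` {i} = (if i \<in> I then E i else {})" for i
    using Q E_unique by (auto intro: E_unique[OF Q(1) _ Q(2)])
  have E_meas: "E i \<in> sets borel" for i
  proof (cases "I - {i} = {}")
    case True
    then show ?thesis unfolding E_def by (metis INT_empty sets.top space_borel)
  next
    case False
    then show ?thesis
      unfolding E_def using G_meas finI by (intro sets.finite_INT) auto
  qed
  have "Q \<in> Qc M"
    unfolding Qc_def
  proof (intro CollectI conjI allI)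
    show "Q \<in> borel \<rightarrow>\<^sub>M count_space UNIV"
      using E_meas by (intro measurable_count_space_eq2_countable[THEN iffD2]) (auto simp: vim)
    show "range Q \<subseteq> {1..M}" using Q(1) by (auto simp: I_def)
    show "convex (Q -` {i})" for i
      by (auto simp: vim E_def intro!: convex_INT G_conv)
  qed
  \<comment> \<open>A nonzero normal makes all separating inequalities strict on the interior, where
    the tie-breaking rule therefore has no influence.\<close>
  moreover have "Q x = i" if "i \<in> {1..M}" "x \<in> interior (B i)" for i x
  proof -
    have iI: "i \<in> I" using that by (auto simp: I_def dest: interior_subset[THEN subsetD])
    have "x \<in> G i j" if "j \<in> I" "j \<noteq> i" for j
    proof -
      have "B i \<subseteq> {x. a i j \<bullet> x \<le> b i j}" using a_le[of i j] iI that by auto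
      then have "interior (B i) \<subseteq> interior {x. a i j \<bullet> x \<le> b i j}" by (rule interior_mono)
      also have "\<dots> = {x. a i j \<bullet> x < b i j}" using a_ne[of i j] iI that by simp
      finally show ?thesis using \<open>x \<in> interior (B i)\<close> by (auto simp: G_def)
    qed
    then have "x \<in> E i" by (auto simp: E_def)
    then show ?thesis using E_unique[OF Q(1) iI Q(2)] by auto
  qed
  ultimately show ?thesis using that by blast
qed

lemma Qc_sequentially_compact:
  fixes Qs :: "nat \<Rightarrow> 'a::euclidean_space \<Rightarrow> nat"
  assumes Qs: "\<And>n. Qs n \<in> Qc M"
  obtains r Q where "strict_mono r" "Q \<in> Qc M"
    "AE x in lborel. eventually (\<lambda>n. Qs (r n) x = Q x) sequentially"
proof -
  obtain D :: "'a set" where D: "countable D" "\<And>X. open X \<Longrightarrow> X \<noteq> {} \<Longrightarrow> \<exists>d\<in>D. d \<in> X"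
    using countable_dense_setE by blast
  have rng: "Qs n x \<in> {1..M}" for n x using Qs[of n] rangeI[of "Qs n" x] unfolding Qc_def by blast
  obtain r l where r: "strict_mono r"
    and l: "\<And>q. eventually (\<lambda>n. Qs (r n) (from_nat_into D q) = l q) sequentially"
    using diagonal_finite_range[of "\<lambda>n q. Qs n (from_nat_into D q)" M] rng by blast
  define B where "B i = {x. eventually (\<lambda>n. Qs (r n) x = i) sequentially}" for i
  have conv: "convex (B i)" for i
  proof (rule convexI)
    fix x y and u v :: real assume xy: "x \<in> B i" "y \<in> B i" and uv: "0 \<le> u" "0 \<le> v" "u + v = 1"
    have "eventually (\<lambda>n. Qs (r n) x = i \<and> Qs (r n) y = i) sequentially"
      using xy by (auto simp: B_def eventually_conj_iff)
    then have "eventually (\<lambda>n. Qs (r n) (u *\<^sub>R x + v *\<^sub>R y) = i) sequentially"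
    proof eventually_elim
      case (elim n)
      have "convex (Qs (r n) -` {i})" using Qs[of "r n"] by (auto simp: Qc_def)
      from convexD[OF this _ _ uv] elim show ?case by auto
    qed
    then show "u *\<^sub>R x + v *\<^sub>R y \<in> B i" by (simp add: B_def)
  qed
  have disj: "B i \<inter> B j = {}" if "i \<noteq> j" for i j
  proof -
    have False if "x \<in> B i" "x \<in> B j" for x
    proof -
      have "eventually (\<lambda>n. Qs (r n) x = i \<and> Qs (r n) x = j) sequentially"
        using that by (auto simp: B_def eventually_conj_iff)
      then have "eventually (\<lambda>n. False) sequentially" by eventually_elim (use \<open>i \<noteq> j\<close> in auto)
      then show False by simp
    qed
    then show ?thesis by auto
  qed
  have DB: "d \<in> (\<Union>i\<in>{1..M}. B i)" if "d \<in> D" for d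
  proof -
    obtain q where q: "from_nat_into D q = d" using from_nat_into_surj[OF D(1) \<open>d \<in> D\<close>] by blast
    obtain n where "Qs (r n) d = l q" using l[of q] q by (auto simp: eventually_sequentially)
    then have "l q \<in> {1..M}" using rng by metis
    then show ?thesis using l[of q] q by (auto simp: B_def)
  qed
  \<comment> \<open>The finite number of labels enters here: a finite union of closures is closed,
    so it is everything as soon as it contains the dense set \<open>D\<close>.\<close>
  have "closed (\<Union>i\<in>{1..M}. closure (B i))" by (intro closed_UN) auto
  moreover have "D \<subseteq> (\<Union>i\<in>{1..M}. closure (B i))" using DB closure_subset by blast
  ultimately have cover: "(\<Union>i\<in>{1..M}. closure (B i)) = UNIV"
    using D(2)[of "- (\<Union>i\<in>{1..M}. closure (B i))"] by (metis Compl_empty_eq ComplD double_complement open_Compl subsetD)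
  obtain Q where Q: "Q \<in> Qc M" "\<And>i x. i \<in> {1..M} \<Longrightarrow> x \<in> interior (B i) \<Longrightarrow> Q x = i"
    using convex_borel_partition[OF conv disj cover] by blast
  have fr: "AE x in lborel. x \<notin> frontier (B i)" for i
  proof -
    have "frontier (B i) \<in> null_sets lebesgue"
      using negligible_convex_frontier[OF conv] by (simp add: negligible_iff_null_sets)
    then have "frontier (B i) \<in> null_sets lborel"
      by (simp add: null_sets_completion_iff)
    then show ?thesis by (rule AE_not_in)
  qed
  have "AE x in lborel. \<forall>i\<in>{1..M}. x \<notin> frontier (B i)"
    using fr by (intro AE_finite_allI) auto
  then have "AE x in lborel. eventually (\<lambda>n. Qs (r n) x = Q x) sequentially"
  \<comment> \<open>Off all the frontiers, a point in the closure of \<open>B i\<close> is in its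
    interior, where the eventual label of the subsequence and the value of \<open>Q\<close> are both
    \<open>i\<close>.\<close>
  proof eventually_elim
    case (elim x)
    obtain i where i: "i \<in> {1..M}" "x \<in> closure (B i)" using cover by blast
    then have "x \<in> interior (B i)" using elim by (auto simp: frontier_def)
    then show ?case using Q(2)[OF i(1)] interior_subset[of "B i"] by (auto simp: B_def)
  qed
  then show ?thesis using that r Q(1) by blast
qed

section \<open>Densities with finite second moment\<close>

text \<open>The summand 1 lets a single function dominate indicators, \<open>norm x\<close> and
  \<open>(norm x)\<^sup>2\<close>, that is, the integrands for mass, barycenter and second moment of
  a cell.\<close>

definition weight :: "'a::real_normed_vector \<Rightarrow> real" where
  "weight x = 1 + (norm x)\<^sup>2"

definition dmeas :: "('a::euclidean_space \<Rightarrow> real) \<Rightarrow> 'a measure" where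
  "dmeas g = density lborel (\<lambda>x. ennreal (g x))"

text \<open>Neither a bound nor a Lipschitz condition is imposed: the density of \<open>pi0\<close>
  may be merely measurable, and updates stay inside this class.\<close>

definition dens :: "('a::euclidean_space \<Rightarrow> real) \<Rightarrow> bool" where
  "dens g \<longleftrightarrow> g \<in> borel_measurable borel \<and> (\<forall>x. 0 \<le> g x) \<and> (\<integral>x. g x \<partial>lborel) = 1 \<and>
     integrable lborel (\<lambda>x. weight x * g x)"

text \<open>Tailored to Scheffe's lemma for the functions \<open>weight x * gs n x\<close>. The
  conditions are checked directly for updated measures, so no tail estimate has to be carried
  through the induction.\<close>

definition dconv :: "(nat \<Rightarrow> 'a::euclidean_space \<Rightarrow> real) \<Rightarrow> ('a \<Rightarrow> real) \<Rightarrow> bool" where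
  "dconv gs g \<longleftrightarrow> (\<forall>n. dens (gs n)) \<and> dens g \<and> (AE x in lborel. (\<lambda>n. gs n x) \<longlonglongrightarrow> g x) \<and>
     (\<lambda>n. \<integral>x. weight x * gs n x \<partial>lborel) \<longlonglongrightarrow> (\<integral>x. weight x * g x \<partial>lborel)"

lemma weight_ge_1: "1 \<le> weight x"
  by (simp add: weight_def)

lemma weight_nonneg: "0 \<le> weight x"
  using weight_ge_1[of x] by linarith

lemma norm_le_weight: "norm x \<le> weight x"
proof -
  have "0 \<le> (norm x - 1)\<^sup>2" by simp
  also have "\<dots> = weight x - 2 * norm x" by (simp add: weight_def power2_diff)
  finally show ?thesis using norm_ge_zero[of x] by linarith
qed

lemma norm_sq_le_weight: "(norm x)\<^sup>2 \<le> weight x"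
  by (simp add: weight_def)

lemma norm_add_sq_le: "(norm (x + y))\<^sup>2 \<le> 2 * (norm x)\<^sup>2 + 2 * (norm y)\<^sup>2"
  for x y :: "'a::real_normed_vector"
proof -
  have "(norm (x + y))\<^sup>2 \<le> (norm x + norm y)\<^sup>2"
    by (intro power_mono norm_triangle_ineq) auto
  also have "\<dots> \<le> 2 * (norm x)\<^sup>2 + 2 * (norm y)\<^sup>2"
    using zero_le_power2[of "norm x - norm y"] by (simp add: power2_eq_square algebra_simps)
  finally show ?thesis .
qed

lemma norm_diff_sq_le_weight: "(norm (x - u))\<^sup>2 \<le> (2 + 2 * (norm u)\<^sup>2) * weight x"
  for x u :: "'a::real_normed_vector"
proof -
  have "(norm (x - u))\<^sup>2 \<le> 2 * (norm x)\<^sup>2 + 2 * (norm u)\<^sup>2"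
    using norm_add_sq_le[of x "- u"] by simp
  also have "\<dots> \<le> (2 + 2 * (norm u)\<^sup>2) * weight x"
    by (simp add: weight_def algebra_simps)
  finally show ?thesis .
qed

lemma weight_measurable [measurable]: "weight \<in> borel_measurable borel"
  unfolding weight_def by measurable

lemma densD:
  assumes "dens g"
  shows "g \<in> borel_measurable borel" "0 \<le> g x" "(\<integral>x. g x \<partial>lborel) = 1"
    "integrable lborel (\<lambda>x. weight x * g x)" "integrable lborel g"
proof -
  show "g \<in> borel_measurable borel" "0 \<le> g x" "(\<integral>x. g x \<partial>lborel) = 1"
    "integrable lborel (\<lambda>x. weight x * g x)" using assms by (auto simp: dens_def)
  then show "integrable lborel g" using not_integrable_integral_eq[of lborel g] by (metis zero_neq_one)
qed

lemma dens_integrable: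
  fixes F :: "'a::euclidean_space \<Rightarrow> 'b::{banach, second_countable_topology}"
  assumes g: "dens g" and F: "F \<in> borel_measurable borel" and le: "\<And>x. norm (F x) \<le> c * weight x"
  shows "integrable lborel (\<lambda>x. g x *\<^sub>R F x)"
proof (rule Bochner_Integration.integrable_bound)
  show "integrable lborel (\<lambda>x. c * (weight x * g x))" using densD(4)[OF g] by simp
  show "(\<lambda>x. g x *\<^sub>R F x) \<in> borel_measurable lborel" using densD(1)[OF g] F by simp
  have "norm (g x *\<^sub>R F x) \<le> norm (c * (weight x * g x))" for x
  proof -
    have "norm (g x *\<^sub>R F x) = g x * norm (F x)" using densD(2)[OF g] by simp
    also have "\<dots> \<le> g x * (c * weight x)" by (intro mult_left_mono le densD(2)[OF g])
    also have "\<dots> \<le> norm (c * (weight x * g x))" by (simp add: mult_ac)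
    finally show ?thesis .
  qed
  then show "AE x in lborel. norm (g x *\<^sub>R F x) \<le> norm (c * (weight x * g x))" by simp
qed

lemma nn_integral_dmeas:
  assumes g: "dens g" and F: "F \<in> borel_measurable borel" and nonneg: "\<And>x. 0 \<le> F x"
    and le: "\<And>x. F x \<le> c * weight x"
  shows "(\<integral>\<^sup>+x. ennreal (F x) \<partial>dmeas g) = ennreal (\<integral>x. g x * F x \<partial>lborel)"
proof -
  have "(\<integral>\<^sup>+x. ennreal (F x) \<partial>dmeas g) = (\<integral>\<^sup>+x. ennreal (g x) * ennreal (F x) \<partial>lborel)"
    unfolding dmeas_def using densD(1)[OF g] F by (intro nn_integral_density) auto
  also have "\<dots> = (\<integral>\<^sup>+x. ennreal (g x * F x) \<partial>lborel)"
    using densD(2)[OF g] nonneg by (simp add: ennreal_mult)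
  also have "\<dots> = ennreal (\<integral>x. g x * F x \<partial>lborel)"
    using dens_integrable[OF g F, of c] le nonneg densD(2)[OF g] by (intro nn_integral_eq_integral) auto
  finally show ?thesis .
qed

lemma indicator_le_weight: "indicator A x \<le> weight x"
  using weight_ge_1[of x] by (auto simp: indicator_def intro: order_trans[OF _ weight_ge_1])

lemma emeasure_dmeas:
  assumes g: "dens g" and A: "A \<in> sets borel"
  shows "emeasure (dmeas g) A = ennreal (\<integral>x. g x * indicator A x \<partial>lborel)"
proof -
  have "emeasure (dmeas g) A = (\<integral>\<^sup>+x. ennreal (indicator A x) \<partial>dmeas g)"
    using A by (simp add: dmeas_def ennreal_indicator)
  also have "\<dots> = ennreal (\<integral>x. g x * indicator A x \<partial>lborel)"
    using A by (intro nn_integral_dmeas[OF g, of _ 1]) (auto simp: indicator_le_weight)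
  finally show ?thesis .
qed

text \<open>The error splits in two. Replacing \<open>gs n\<close> by \<open>g\<close> costs at most
  \<open>c\<close> times the weighted L1 distance, uniformly in the integrand; with \<open>g\<close>
  fixed, dominated convergence with majorant \<open>c * (weight x * g x)\<close> finishes. Vector
  values are allowed because barycenters are needed.\<close>

lemma dconv_integral_tendsto:
  fixes F :: "'a::euclidean_space \<Rightarrow> 'b::{banach, second_countable_topology}"
  assumes d: "dconv gs g"
    and Fs [measurable]: "\<And>n. Fs n \<in> borel_measurable borel" and F [measurable]: "F \<in> borel_measurable borel"
    and le: "\<And>n x. norm (Fs n x) \<le> c * weight x" "\<And>x. norm (F x) \<le> c * weight x"
    and lim: "AE x in lborel. (\<lambda>n. Fs n x) \<longlonglongrightarrow> F x"
  shows "(\<lambda>n. \<integral>x. gs n x *\<^sub>R Fs n x \<partial>lborel) \<longlonglongrightarrow> (\<integral>x. g x *\<^sub>R F x \<partial>lborel)"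
proof -
  have dn: "dens (gs n)" and dg: "dens g" for n using d by (auto simp: dconv_def)
  note [measurable] = densD(1)[OF dn] densD(1)[OF dg]
  have nn: "(\<integral>\<^sup>+x. norm (weight x * h x) \<partial>lborel) = ennreal (\<integral>x. weight x * h x \<partial>lborel)" if "dens h" for h :: "'a \<Rightarrow> real"
    using that densD(2,4)[OF that] by (subst nn_integral_eq_integral) (auto simp: weight_nonneg abs_mult)
  have "(\<lambda>n. ennreal (\<integral>x. weight x * gs n x \<partial>lborel)) \<longlonglongrightarrow> ennreal (\<integral>x. weight x * g x \<partial>lborel)"
    using d by (intro tendsto_ennrealI) (auto simp: dconv_def)
  then have "limsup (\<lambda>n. \<integral>\<^sup>+x. norm (weight x * gs n x) \<partial>lborel) \<le> (\<integral>\<^sup>+x. norm (weight x * g x) \<partial>lborel)"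
    unfolding nn[OF dn] nn[OF dg] by (simp add: lim_imp_Limsup)
  then have "(\<lambda>n. \<integral>\<^sup>+x. norm (weight x * gs n x - weight x * g x) \<partial>lborel) \<longlonglongrightarrow> 0"
    using d densD(4) by (intro Scheffe_lemma1) (auto simp: dconv_def intro!: tendsto_intros)
  moreover have int_d: "integrable lborel (\<lambda>x. weight x * gs n x - weight x * g x)" for n
    using densD(4)[OF dn] densD(4)[OF dg] by auto
  ultimately have "(\<lambda>n. ennreal (\<integral>x. norm (weight x * gs n x - weight x * g x) \<partial>lborel)) \<longlonglongrightarrow> ennreal 0"
    by (subst (asm) nn_integral_eq_integral) auto
  then have l1: "(\<lambda>n. \<integral>x. norm (weight x * gs n x - weight x * g x) \<partial>lborel) \<longlonglongrightarrow> 0"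
    by (subst (asm) tendsto_ennreal_iff) auto
  have int1: "integrable lborel (\<lambda>x. gs n x *\<^sub>R Fs n x)" and int2: "integrable lborel (\<lambda>x. g x *\<^sub>R Fs n x)" for n
    by (rule dens_integrable[OF dn Fs le(1)], rule dens_integrable[OF dg Fs le(1)])
  have bnd: "norm ((\<integral>x. gs n x *\<^sub>R Fs n x \<partial>lborel) - (\<integral>x. g x *\<^sub>R Fs n x \<partial>lborel))
      \<le> c * (\<integral>x. norm (weight x * gs n x - weight x * g x) \<partial>lborel)" for n
  proof -
    have "norm ((\<integral>x. gs n x *\<^sub>R Fs n x \<partial>lborel) - (\<integral>x. g x *\<^sub>R Fs n x \<partial>lborel))
      = norm (\<integral>x. gs n x *\<^sub>R Fs n x - g x *\<^sub>R Fs n x \<partial>lborel)"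
      using int1 int2 by simp
    also have "\<dots> \<le> (\<integral>x. c * norm (weight x * gs n x - weight x * g x) \<partial>lborel)"
    proof (rule Bochner_Integration.integral_norm_bound_integral)
      fix x
      have "norm (gs n x *\<^sub>R Fs n x - g x *\<^sub>R Fs n x) = \<bar>gs n x - g x\<bar> * norm (Fs n x)"
        by (simp flip: scaleR_diff_left)
      also have "\<dots> \<le> \<bar>gs n x - g x\<bar> * (c * weight x)" by (intro mult_left_mono le) auto
      also have "\<dots> = c * norm (weight x * gs n x - weight x * g x)"
        by (simp flip: right_diff_distrib add: abs_mult weight_nonneg mult_ac)
      finally show "norm (gs n x *\<^sub>R Fs n x - g x *\<^sub>R Fs n x) \<le> c * norm (weight x * gs n x - weight x * g x)" .
    qed (use int1 int2 int_d in auto)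
    finally show ?thesis by simp
  qed
  have "(\<lambda>n. c * (\<integral>x. norm (weight x * gs n x - weight x * g x) \<partial>lborel)) \<longlonglongrightarrow> c * 0"
    by (intro tendsto_intros l1)
  then have l2: "(\<lambda>n. c * (\<integral>x. norm (weight x * gs n x - weight x * g x) \<partial>lborel)) \<longlonglongrightarrow> 0"
    by simp
  have A: "(\<lambda>n. (\<integral>x. gs n x *\<^sub>R Fs n x \<partial>lborel) - (\<integral>x. g x *\<^sub>R Fs n x \<partial>lborel)) \<longlonglongrightarrow> 0"
    by (rule Lim_null_comparison[OF always_eventually[OF allI[OF bnd]] l2])
  have B: "(\<lambda>n. \<integral>x. g x *\<^sub>R Fs n x \<partial>lborel) \<longlonglongrightarrow> (\<integral>x. g x *\<^sub>R F x \<partial>lborel)"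
  proof (rule integral_dominated_convergence)
    show "integrable lborel (\<lambda>x. c * (weight x * g x))" using densD(4)[OF dg] by simp
    show "AE x in lborel. (\<lambda>n. g x *\<^sub>R Fs n x) \<longlonglongrightarrow> g x *\<^sub>R F x"
      using lim by eventually_elim (intro tendsto_intros)
    have "norm (g x *\<^sub>R Fs n x) \<le> c * (weight x * g x)" for n x
      using mult_left_mono[OF le(1)[of n x] densD(2)[OF dg, of x]] densD(2)[OF dg, of x]
      by (simp add: mult_ac)
    then show "AE x in lborel. norm (g x *\<^sub>R Fs n x) \<le> c * (weight x * g x)" for n by simp
  qed auto
  from tendsto_add[OF A B] show ?thesis by simp
qed

text \<open>Cells may move with \<open>n\<close>: at almost every point membership is eventually
  constant, so the indicators converge there.\<close>

lemma dconv_cell_integral_tendsto: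
  fixes F :: "'a::euclidean_space \<Rightarrow> 'b::{banach, second_countable_topology}"
  assumes d: "dconv gs g" and [measurable]: "\<And>n. As n \<in> sets borel" "A \<in> sets borel" "F \<in> borel_measurable borel"
    and le: "\<And>x. norm (F x) \<le> c * weight x"
    and lim: "AE x in lborel. eventually (\<lambda>n. x \<in> As n \<longleftrightarrow> x \<in> A) sequentially"
  shows "(\<lambda>n. \<integral>x. gs n x *\<^sub>R (indicat_real (As n) x *\<^sub>R F x) \<partial>lborel) \<longlonglongrightarrow>
    (\<integral>x. g x *\<^sub>R (indicat_real A x *\<^sub>R F x) \<partial>lborel)"
proof (rule dconv_integral_tendsto[OF d, where c=c])
  have "norm (indicat_real S x *\<^sub>R F x) \<le> c * weight x" for S x
    using le[of x] norm_ge_zero[of "F x"] by (auto simp: indicator_def simp del: norm_ge_zero)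
  then show "norm (indicat_real (As n) x *\<^sub>R F x) \<le> c * weight x"
    "norm (indicat_real A x *\<^sub>R F x) \<le> c * weight x" for n x by auto
  show "AE x in lborel. (\<lambda>n. indicat_real (As n) x *\<^sub>R F x) \<longlonglongrightarrow> indicat_real A x *\<^sub>R F x"
    using lim
  proof eventually_elim
    case (elim x)
    then have "eventually (\<lambda>n. indicat_real (As n) x *\<^sub>R F x = indicat_real A x *\<^sub>R F x) sequentially"
      by eventually_elim (simp add: indicator_def)
    then show ?case by (rule tendsto_eventually)
  qed
qed simp_all

text \<open>A nonnegative function with integral 0 vanishes almost everywhere, so \<open>g\<close>
  is 0 almost everywhere on such a cell.\<close>

lemma dens_null_cell:
  fixes F :: "'a::euclidean_space \<Rightarrow> 'b::{banach, second_countable_topology}"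
  assumes g: "dens g" and A: "A \<in> sets borel" and c: "(\<integral>x. g x * indicator A x \<partial>lborel) = 0"
  shows "(\<integral>x. g x *\<^sub>R (indicat_real A x *\<^sub>R F x) \<partial>lborel) = 0"
proof -
  have "integrable lborel (\<lambda>x. g x *\<^sub>R indicat_real A x)"
    using A by (intro dens_integrable[OF g, of _ 1]) (auto simp: indicator_le_weight)
  then have "AE x in lborel. g x * indicator A x = 0"
    using c densD(2)[OF g] by (subst integral_nonneg_eq_0_iff_AE[symmetric]) auto
  then have "AE x in lborel. g x *\<^sub>R (indicat_real A x *\<^sub>R F x) = 0"
    by eventually_elim auto
  then show ?thesis by (simp add: integral_eq_zero_AE)
qed

section \<open>Continuity of the quantization cost\<close>

text \<open>The unnormalized variance of the cell: second moment minus squared first moment over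
  mass. It is the distortion when the whole cell is coded by its centroid.\<close>

definition cell_cost :: "('a::euclidean_space \<Rightarrow> real) \<Rightarrow> 'a set \<Rightarrow> real" where
  "cell_cost g A = (\<integral>x. g x * (indicator A x * (norm x)\<^sup>2) \<partial>lborel)
     - (norm (\<integral>x. g x *\<^sub>R (indicat_real A x *\<^sub>R x) \<partial>lborel))\<^sup>2 / (\<integral>x. g x * indicator A x \<partial>lborel)"

text \<open>If the cell is null the division by zero is harmless, since then the first integral vanishes too.\<close>

lemma INF_cell_cost:
  fixes g :: "'a::euclidean_space \<Rightarrow> real"
  assumes g: "dens g" and A [measurable]: "A \<in> sets borel"
  shows "(INF u. \<integral>\<^sup>+ x. indicator A x * ennreal ((norm (x - u))\<^sup>2) \<partial>dmeas g) = ennreal (cell_cost g A)"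
    and "0 \<le> cell_cost g A"
proof -
  define a where "a = (\<integral>x. g x * (indicator A x * (norm x)\<^sup>2) \<partial>lborel)"
  define b where "b = (\<integral>x. g x *\<^sub>R (indicat_real A x *\<^sub>R x) \<partial>lborel)"
  define c where "c = (\<integral>x. g x * indicator A x \<partial>lborel)"
  note [measurable] = densD(1)[OF g]
  have c0: "c \<ge> 0" unfolding c_def using densD(2)[OF g] by (intro integral_nonneg_AE) auto
  have ind: "norm (indicat_real A x *\<^sub>R y) \<le> norm y" for x and y :: "'b::real_normed_vector"
    by (simp add: indicator_def)
  have ia: "integrable lborel (\<lambda>x. g x * (indicator A x * (norm x)\<^sup>2))"
  proof -
    have "norm (indicat_real A x * (norm x)\<^sup>2) \<le> 1 * weight x" for x :: 'a
      using norm_sq_le_weight[of x] weight_nonneg[of x] by (simp add: indicator_def)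
    then show ?thesis
      using dens_integrable[OF g, of "\<lambda>x. indicator A x * (norm x)\<^sup>2" 1] by simp
  qed
  have ib: "integrable lborel (\<lambda>x. g x *\<^sub>R (indicat_real A x *\<^sub>R x))"
    by (rule dens_integrable[OF g, of _ 1]) (auto intro: order_trans[OF ind norm_le_weight] simp del: norm_scaleR)
  have ic: "integrable lborel (\<lambda>x. g x * indicator A x)"
    using dens_integrable[OF g, of "indicat_real A" 1] by (simp add: indicator_le_weight)
  have int_val: "(\<integral>x. g x * (indicator A x * (norm (x - u))\<^sup>2) \<partial>lborel) = a - 2 * (u \<bullet> b) + (norm u)\<^sup>2 * c" for u
  proof -
    have "(\<lambda>x. g x * (indicator A x * (norm (x - u))\<^sup>2)) = (\<lambda>x. g x * (indicator A x * (norm x)\<^sup>2)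
        - 2 * (u \<bullet> (g x *\<^sub>R (indicat_real A x *\<^sub>R x))) + (norm u)\<^sup>2 * (g x * indicator A x))"
      by (intro ext) (simp add: power2_norm_eq_inner algebra_simps inner_commute)
    moreover have "(\<integral>x. u \<bullet> (g x *\<^sub>R (indicat_real A x *\<^sub>R x)) \<partial>lborel) = u \<bullet> b"
      unfolding b_def using ib by (intro integral_inner_right) auto
    moreover have "integrable lborel (\<lambda>x. u \<bullet> (g x *\<^sub>R (indicat_real A x *\<^sub>R x)))"
      using ib by (intro integrable_inner_right) auto
    ultimately show ?thesis
      using ia ic by (simp add: a_def c_def del: inner_scaleR_right)
  qed
  have val: "(\<integral>\<^sup>+ x. indicator A x * ennreal ((norm (x - u))\<^sup>2) \<partial>dmeas g) = ennreal (a - 2 * (u \<bullet> b) + (norm u)\<^sup>2 * c)" for u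
  proof -
    have "(\<integral>\<^sup>+ x. indicator A x * ennreal ((norm (x - u))\<^sup>2) \<partial>dmeas g)
        = (\<integral>\<^sup>+ x. ennreal (indicator A x * (norm (x - u))\<^sup>2) \<partial>dmeas g)"
      by (intro nn_integral_cong) (auto simp: indicator_def)
    also have "\<dots> = ennreal (\<integral>x. g x * (indicator A x * (norm (x - u))\<^sup>2) \<partial>lborel)"
    proof (rule nn_integral_dmeas[OF g])
      show "indicator A x * (norm (x - u))\<^sup>2 \<le> (2 + 2 * (norm u)\<^sup>2) * weight x" for x
        using norm_diff_sq_le_weight[of x u] weight_nonneg[of x] by (auto simp: indicator_def)
    qed auto
    finally show ?thesis unfolding int_val .
  qed
  have cc: "cell_cost g A = a - (norm b)\<^sup>2 / c" by (simp add: cell_cost_def a_def b_def c_def)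
  \<comment> \<open>Completing the square at the centroid \<open>b /\<^sub>R c\<close>. For
    \<open>c = 0\<close> the first moment \<open>b\<close> vanishes as well, and both sides reduce
    to \<open>a\<close>.\<close>
  have sq: "a - 2 * (u \<bullet> b) + (norm u)\<^sup>2 * c = cell_cost g A + c * (norm (u - b /\<^sub>R c))\<^sup>2" for u
  proof (cases "c = 0")
    case True
    then have "b = 0" unfolding b_def c_def by (intro dens_null_cell[OF g A])
    then show ?thesis using True by (simp add: cc)
  next
    case False
    then show ?thesis
      by (simp add: cc power2_norm_eq_inner algebra_simps inner_commute inner_diff_right inner_diff_left) (simp add: field_simps)
  qed
  show pos: "0 \<le> cell_cost g A"
  proof -
    \<comment> \<open>At the centroid the square in \<open>sq\<close> disappears, so the cost is
      itself an integral of a nonnegative function.\<close>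
    have "0 \<le> (\<integral>x. g x * (indicator A x * (norm (x - b /\<^sub>R c))\<^sup>2) \<partial>lborel)"
      using densD(2)[OF g] by (intro integral_nonneg_AE) auto
    also have "\<dots> = cell_cost g A" unfolding int_val sq by simp
    finally show ?thesis .
  qed
  show "(INF u. \<integral>\<^sup>+ x. indicator A x * ennreal ((norm (x - u))\<^sup>2) \<partial>dmeas g) = ennreal (cell_cost g A)"
    unfolding val sq
  proof (rule antisym)
    show "(INF u. ennreal (cell_cost g A + c * (norm (u - b /\<^sub>R c))\<^sup>2)) \<le> ennreal (cell_cost g A)"
      by (rule INF_lower2[of "b /\<^sub>R c"]) auto
    show "ennreal (cell_cost g A) \<le> (INF u. ennreal (cell_cost g A + c * (norm (u - b /\<^sub>R c))\<^sup>2))"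
      using c0 by (intro INF_greatest ennreal_leI) auto
  qed
qed

text \<open>If the limit cell has mass 0, the quotient in \<open>cell_cost\<close> cannot be passed
  to the limit. The cost is then squeezed between 0 and the second moment over the cell, which tends
  to 0.\<close>

lemma cell_cost_tendsto:
  assumes d: "dconv gs g" and m [measurable]: "\<And>n. As n \<in> sets borel" "A \<in> sets borel"
    and lim: "AE x in lborel. eventually (\<lambda>n. x \<in> As n \<longleftrightarrow> x \<in> A) sequentially"
  shows "(\<lambda>n. cell_cost (gs n) (As n)) \<longlonglongrightarrow> cell_cost g A"
proof -
  have dn: "dens (gs n)" and dg: "dens g" for n using d by (auto simp: dconv_def)
  have a: "(\<lambda>n. \<integral>x. gs n x * (indicator (As n) x * (norm x)\<^sup>2) \<partial>lborel) \<longlonglongrightarrow>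
      (\<integral>x. g x * (indicator A x * (norm x)\<^sup>2) \<partial>lborel)"
    using dconv_cell_integral_tendsto[OF d m _ _ lim, of "\<lambda>x. (norm x)\<^sup>2" 1] norm_sq_le_weight by auto
  have b: "(\<lambda>n. \<integral>x. gs n x *\<^sub>R (indicat_real (As n) x *\<^sub>R x) \<partial>lborel) \<longlonglongrightarrow>
      (\<integral>x. g x *\<^sub>R (indicat_real A x *\<^sub>R x) \<partial>lborel)"
    using dconv_cell_integral_tendsto[OF d m _ _ lim, of "\<lambda>x. x" 1] norm_le_weight by auto
  have c: "(\<lambda>n. \<integral>x. gs n x * indicator (As n) x \<partial>lborel) \<longlonglongrightarrow> (\<integral>x. g x * indicator A x \<partial>lborel)"
    using dconv_cell_integral_tendsto[OF d m _ _ lim, of "\<lambda>x. 1::real" 1] weight_ge_1 by auto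
  show ?thesis
  proof (cases "(\<integral>x. g x * indicator A x \<partial>lborel) = 0")
    case False
    then show ?thesis unfolding cell_cost_def by (intro tendsto_intros a b c)
  next
    case True
    have a0: "(\<integral>x. g x * (indicator A x * (norm x)\<^sup>2) \<partial>lborel) = 0"
      using dens_null_cell[OF dg m(2) True, of "\<lambda>x. (norm x)\<^sup>2"] by simp
    then have "cell_cost g A = 0" using True by (simp add: cell_cost_def)
    moreover have "(\<lambda>n. cell_cost (gs n) (As n)) \<longlonglongrightarrow> 0"
    proof (rule tendsto_sandwich[OF _ _ tendsto_const a[unfolded a0]])
      show "eventually (\<lambda>n. 0 \<le> cell_cost (gs n) (As n)) sequentially"
        using INF_cell_cost(2)[OF dn m(1)] by simp
      have "0 \<le> (\<integral>x. gs n x * indicator (As n) x \<partial>lborel)" for n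
        using densD(2)[OF dn] by (intro integral_nonneg_AE) auto
      then show "eventually (\<lambda>n. cell_cost (gs n) (As n) \<le> (\<integral>x. gs n x * (indicator (As n) x * (norm x)\<^sup>2) \<partial>lborel)) sequentially"
        by (auto simp: cell_cost_def intro!: always_eventually)
    qed
    ultimately show ?thesis by simp
  qed
qed

lemma Qc_cell_measurable: "Q \<in> Qc M \<Longrightarrow> Q -` S \<in> sets borel"
  unfolding Qc_def using measurable_sets[of Q borel "count_space UNIV" S] by auto

lemma qcost_dmeas:
  assumes "dens g" "Q \<in> Qc M"
  shows "qcost M (dmeas g) Q = ennreal (\<Sum>i=1..M. cell_cost g (Q -` {i}))"
  unfolding qcost_def using INF_cell_cost[OF assms(1) Qc_cell_measurable[OF assms(2)]]
  by (simp add: sum_ennreal)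

lemma qcost_tendsto:
  assumes d: "dconv gs g" and Q: "\<And>n. Qs n \<in> Qc M" "Q \<in> Qc M"
    and lim: "AE x in lborel. eventually (\<lambda>n. Qs n x = Q x) sequentially"
  shows "(\<lambda>n. qcost M (dmeas (gs n)) (Qs n)) \<longlonglongrightarrow> qcost M (dmeas g) Q"
proof -
  have dn: "dens (gs n)" and dg: "dens g" for n using d by (auto simp: dconv_def)
  have "AE x in lborel. eventually (\<lambda>n. x \<in> Qs n -` {i} \<longleftrightarrow> x \<in> Q -` {i}) sequentially" for i
    using lim by eventually_elim (auto elim: eventually_mono)
  then show ?thesis
    unfolding qcost_dmeas[OF dn Q(1)] qcost_dmeas[OF dg Q(2)]
    by (intro tendsto_ennrealI tendsto_sum cell_cost_tendsto[OF d] Qc_cell_measurable[OF Q(1)] Qc_cell_measurable[OF Q(2)])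
qed

section \<open>Weak convergence of Lipschitz densities\<close>

definition bump :: "real \<Rightarrow> 'a::metric_space \<Rightarrow> 'a \<Rightarrow> real" where
  "bump r z y = max 0 (r - dist y z)"

lemma bump_continuous: "continuous_on A (bump r z)"
  unfolding bump_def by (intro continuous_intros)

text \<open>The bump lives on a ball of radius \<open>r\<close>, where \<open>g\<close> differs from
  \<open>g z\<close> by at most \<open>C1 * r\<close>, and so does its average. The estimate serves
  twice: for pointwise convergence of densities and for joint measurability of
  \<open>phi\<close>.\<close>

lemma lipschitz_mollify:
  fixes g :: "'a::euclidean_space \<Rightarrow> real"
  assumes lip: "C1-lipschitz_on UNIV g" and r: "r > 0"
  shows "integrable lborel (\<lambda>y. bump r z y * g y)"
    and "0 < (\<integral>y. bump r z y \<partial>lborel)"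
    and "\<bar>(\<integral>y. bump r z y * g y \<partial>lborel) / (\<integral>y. bump r z y \<partial>lborel) - g z\<bar> \<le> C1 * r"
proof -
  have int: "integrable lborel (\<lambda>y. bump r z y * h y)" if "continuous_on UNIV h" for h :: "'a \<Rightarrow> real"
  proof -
    have "integrable lborel (\<lambda>y. indicator (cball z r) y *\<^sub>R (bump r z y * h y))"
      by (intro borel_integrable_compact continuous_intros bump_continuous)
        (auto intro: continuous_on_subset[OF that])
    also have "(\<lambda>y. indicator (cball z r) y *\<^sub>R (bump r z y * h y)) = (\<lambda>y. bump r z y * h y)"
      by (auto simp: fun_eq_iff indicator_def bump_def dist_commute)
    finally show ?thesis .
  qed
  show ig: "integrable lborel (\<lambda>y. bump r z y * g y)"
    using lipschitz_on_continuous_on[OF lip] by (rule int)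
  have ib: "integrable lborel (bump r z)" using int[of "\<lambda>_. 1"] by simp
  show pos: "0 < (\<integral>y. bump r z y \<partial>lborel)"
  proof -
    \<comment> \<open>On the ball of half the radius the bump is at least
      \<open>r / 2\<close>.\<close>
    have "0 < r / 2 * measure lborel (ball z (r / 2))"
      using r content_ball_pos[of "r/2" z] by simp
    also have "\<dots> = (\<integral>y. r / 2 * indicator (ball z (r / 2)) y \<partial>lborel)" by simp
    also have "\<dots> \<le> (\<integral>y. bump r z y \<partial>lborel)"
    proof (rule integral_mono)
      show "integrable lborel (\<lambda>y. r / 2 * indicat_real (ball z (r / 2)) y)"
        by (intro integrable_mult_right integrable_real_indicator) (use emeasure_bounded_finite[OF bounded_ball] in auto)
      show "r / 2 * indicator (ball z (r / 2)) y \<le> bump r z y" for y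
        using r by (auto simp: indicator_def bump_def dist_commute)
    qed (use ib in auto)
    finally show ?thesis .
  qed
  have "\<bar>(\<integral>y. bump r z y * g y \<partial>lborel) - (\<integral>y. bump r z y \<partial>lborel) * g z\<bar>
      = norm (\<integral>y. bump r z y * g y - bump r z y * g z \<partial>lborel)"
    using ig ib by simp
  also have "\<dots> \<le> (\<integral>y. (C1 * r) * bump r z y \<partial>lborel)"
  proof (rule Bochner_Integration.integral_norm_bound_integral)
    show "norm (bump r z y * g y - bump r z y * g z) \<le> (C1 * r) * bump r z y" for y
    proof (cases "dist y z < r")
      case True
      have "\<bar>g y - g z\<bar> \<le> C1 * dist y z"
        using lipschitz_onD[OF lip, of y z] by (simp add: dist_real_def)
      also have "\<dots> \<le> C1 * r" using True lipschitz_on_nonneg[OF lip] by (intro mult_left_mono) auto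
      finally have "bump r z y * \<bar>g y - g z\<bar> \<le> bump r z y * (C1 * r)"
        by (intro mult_left_mono) (auto simp: bump_def)
      moreover have "norm (bump r z y * g y - bump r z y * g z) = bump r z y * \<bar>g y - g z\<bar>"
        unfolding right_diff_distrib[symmetric] by (simp add: abs_mult bump_def)
      ultimately show ?thesis by (simp add: mult.commute)
    qed (simp add: bump_def)
  qed (use ig ib in auto)
  also have "\<dots> = C1 * r * (\<integral>y. bump r z y \<partial>lborel)" by simp
  finally have "\<bar>((\<integral>y. bump r z y * g y \<partial>lborel) - (\<integral>y. bump r z y \<partial>lborel) * g z) / (\<integral>y. bump r z y \<partial>lborel)\<bar> \<le> C1 * r"
    using pos by (simp add: abs_divide divide_le_eq)
  then show "\<bar>(\<integral>y. bump r z y * g y \<partial>lborel) / (\<integral>y. bump r z y \<partial>lborel) - g z\<bar> \<le> C1 * r"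
    using pos by (simp add: diff_divide_distrib)
qed

lemma integral_dmeas:
  fixes h :: "'a::euclidean_space \<Rightarrow> real"
  assumes "g \<in> borel_measurable borel" "\<And>x. 0 \<le> g x" "h \<in> borel_measurable borel"
  shows "(\<integral>x. h x \<partial>dmeas g) = (\<integral>x. g x * h x \<partial>lborel)"
  unfolding dmeas_def using assms by (subst integral_density) auto

lemma lipschitz_borel_measurable:
  fixes g :: "'a::euclidean_space \<Rightarrow> real"
  shows "L-lipschitz_on UNIV g \<Longrightarrow> g \<in> borel_measurable borel"
  by (intro borel_measurable_continuous_onI lipschitz_on_continuous_on)

lemma weakly_converges_density_tendsto:
  fixes g :: "'a::euclidean_space \<Rightarrow> real"
  assumes lip: "\<And>n. L-lipschitz_on UNIV (gs n)" "L-lipschitz_on UNIV g"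
    and nonneg: "\<And>n x. 0 \<le> gs n x" "\<And>x. 0 \<le> g x"
    and weak: "weakly_converges (\<lambda>n. dmeas (gs n)) (dmeas g)"
  shows "(\<lambda>n. gs n z) \<longlonglongrightarrow> g z"
proof (rule LIMSEQ_I)
  fix e :: real assume e: "e > 0"
  have L0: "L \<ge> 0" using lipschitz_on_nonneg[OF lip(2)] .
  \<comment> \<open>Two mollification errors and one error from weak convergence get
    \<open>e / 3\<close> each; adding 1 to \<open>L\<close> covers \<open>L = 0\<close>.\<close>
  define r where "r = e / (3 * (L + 1))"
  have r: "r > 0" using e L0 by (simp add: r_def)
  have "L * r \<le> (L + 1) * r" using r by (simp add: algebra_simps)
  also have "\<dots> = e / 3" using L0 by (simp add: r_def field_simps)
  finally have Lr: "L * r \<le> e / 3" .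
  define c where "c = (\<integral>y. bump r z y \<partial>lborel)"
  have c: "c > 0" unfolding c_def by (rule lipschitz_mollify(2)[OF lip(2) r])
  have bm [measurable]: "bump r z \<in> borel_measurable borel"
    by (intro borel_measurable_continuous_onI bump_continuous)
  have "bounded (range (bump r z))"
    using r by (intro boundedI[of _ r]) (auto simp: bump_def)
  then have "(\<lambda>n. \<integral>x. bump r z x \<partial>dmeas (gs n)) \<longlonglongrightarrow> (\<integral>x. bump r z x \<partial>dmeas g)"
    using weak bump_continuous unfolding weakly_converges_def by blast
  then have "(\<lambda>n. \<integral>x. bump r z x * gs n x \<partial>lborel) \<longlonglongrightarrow> (\<integral>x. bump r z x * g x \<partial>lborel)"
    by (simp add: integral_dmeas lipschitz_borel_measurable[OF lip(1)] lipschitz_borel_measurable[OF lip(2)] nonneg mult.commute)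
  then have "(\<lambda>n. (\<integral>x. bump r z x * gs n x \<partial>lborel) / c) \<longlonglongrightarrow> (\<integral>x. bump r z x * g x \<partial>lborel) / c"
    by (intro tendsto_intros) (use c in auto)
  from LIMSEQ_D[OF this, of "e / 3"] e obtain N where
    N: "\<And>n. n \<ge> N \<Longrightarrow> \<bar>(\<integral>x. bump r z x * gs n x \<partial>lborel) / c - (\<integral>x. bump r z x * g x \<partial>lborel) / c\<bar> < e / 3"
    by auto
  have "norm (gs n z - g z) < e" if "n \<ge> N" for n
  proof -
    have "\<bar>(\<integral>x. bump r z x * gs n x \<partial>lborel) / c - gs n z\<bar> \<le> L * r"
      unfolding c_def by (rule lipschitz_mollify(3)[OF lip(1) r])
    moreover have "\<bar>(\<integral>x. bump r z x * g x \<partial>lborel) / c - g z\<bar> \<le> L * r"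
      unfolding c_def by (rule lipschitz_mollify(3)[OF lip(2) r])
    ultimately show ?thesis using N[OF that] Lr unfolding real_norm_def by linarith
  qed
  then show "\<exists>N. \<forall>n\<ge>N. norm (gs n z - g z) < e" by blast
qed

section \<open>From weak convergence with uniformly small tails to convergence of second
  moments\<close>

lemma densI:
  fixes g :: "'a::euclidean_space \<Rightarrow> real"
  assumes [measurable]: "g \<in> borel_measurable borel" and nonneg: "\<And>x. 0 \<le> g x"
    and prob: "prob_space (dmeas g)" and fin: "(\<integral>\<^sup>+x. ennreal ((norm x)\<^sup>2) \<partial>dmeas g) < \<infinity>"
  shows "dens g"
proof -
  have one: "(\<integral>\<^sup>+x. ennreal (g x) \<partial>lborel) = 1"
    using prob_space.emeasure_space_1[OF prob] by (simp add: dmeas_def emeasure_density)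
  then have ig: "integrable lborel g" using nonneg by (intro integrableI_nonneg) auto
  have "(\<integral>\<^sup>+x. ennreal ((norm x)\<^sup>2 * g x) \<partial>lborel) < \<infinity>"
    using fin nonneg by (simp add: dmeas_def nn_integral_density ennreal_mult mult.commute)
  then have "integrable lborel (\<lambda>x. (norm x)\<^sup>2 * g x)" using nonneg by (intro integrableI_nonneg) auto
  then have "integrable lborel (\<lambda>x. weight x * g x)"
    using ig by (simp add: weight_def distrib_right)
  moreover have "(\<integral>x. g x \<partial>lborel) = 1"
    using one nonneg by (subst integral_eq_nn_integral) auto
  ultimately show ?thesis using nonneg by (simp add: dens_def)
qed

text \<open>Fatou's lemma, meant for handing the uniform tail bounds of a sequence on to its
  limit.\<close>

lemma nn_integral_dmeas_liminf_le:
  fixes g :: "'a::euclidean_space \<Rightarrow> real"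
  assumes [measurable]: "\<And>n. gs n \<in> borel_measurable borel" "g \<in> borel_measurable borel" "F \<in> borel_measurable borel"
    and nonneg: "\<And>n x. 0 \<le> gs n x" "\<And>x. 0 \<le> g x" "\<And>x. 0 \<le> F x"
    and lim: "\<And>x. (\<lambda>n. gs n x) \<longlonglongrightarrow> g x"
    and le: "\<And>n. (\<integral>\<^sup>+x. ennreal (F x) \<partial>dmeas (gs n)) \<le> B"
  shows "(\<integral>\<^sup>+x. ennreal (F x) \<partial>dmeas g) \<le> B"
proof -
  have eq: "(\<integral>\<^sup>+x. ennreal (F x) \<partial>dmeas h) = (\<integral>\<^sup>+x. ennreal (h x * F x) \<partial>lborel)"
    if "h \<in> borel_measurable borel" "\<And>x. 0 \<le> h x" for h :: "'a \<Rightarrow> real"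
    using that nonneg(3) by (simp add: dmeas_def nn_integral_density ennreal_mult)
  have "ennreal (g x * F x) = liminf (\<lambda>n. ennreal (gs n x * F x))" for x
  proof -
    have "(\<lambda>n. ennreal (gs n x * F x)) \<longlonglongrightarrow> ennreal (g x * F x)"
      by (intro tendsto_ennrealI tendsto_intros lim)
    then show ?thesis by (simp add: lim_imp_Liminf)
  qed
  then have "(\<integral>\<^sup>+x. ennreal (F x) \<partial>dmeas g) = (\<integral>\<^sup>+x. liminf (\<lambda>n. ennreal (gs n x * F x)) \<partial>lborel)"
    by (simp add: eq nonneg)
  also have "\<dots> \<le> liminf (\<lambda>n. \<integral>\<^sup>+x. ennreal (gs n x * F x) \<partial>lborel)"
    by (intro nn_integral_liminf) auto
  also have "\<dots> \<le> B"
    using le by (intro Liminf_le) (auto simp: eq nonneg)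
  finally show ?thesis .
qed

text \<open>The truncated square \<open>min ((norm x)\<^sup>2) R\<close> is a bounded continuous
  test function, so weak convergence applies to it. The truncation error is controlled by the tail
  beyond \<open>R\<close>, uniformly along the sequence and also for the limit.\<close>

lemma weakly_converges_dconv:
  fixes g :: "'a::euclidean_space \<Rightarrow> real"
  assumes lip: "\<And>n. L-lipschitz_on UNIV (gs n)" "L-lipschitz_on UNIV g"
    and nonneg: "\<And>n x. 0 \<le> gs n x" "\<And>x. 0 \<le> g x"
    and prob: "\<And>n. prob_space (dmeas (gs n))" "prob_space (dmeas g)"
    and weak: "weakly_converges (\<lambda>n. dmeas (gs n)) (dmeas g)"
    and ui: "((\<lambda>R. SUP n. \<integral>\<^sup>+ x. indicator {x. (norm x)\<^sup>2 \<ge> R} x * ennreal ((norm x)\<^sup>2) \<partial>dmeas (gs n))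
               \<longlongrightarrow> 0) at_top"
  shows "dconv gs g"
proof -
  note lim = weakly_converges_density_tendsto[OF lip nonneg weak]
  note [measurable] = lipschitz_borel_measurable[OF lip(1)] lipschitz_borel_measurable[OF lip(2)]
  have tail: "\<exists>R>0. (\<forall>n. (\<integral>\<^sup>+x. ennreal (indicator {x. (norm x)\<^sup>2 \<ge> R} x * (norm x)\<^sup>2) \<partial>dmeas (gs n)) \<le> ennreal e)
      \<and> (\<integral>\<^sup>+x. ennreal (indicator {x. (norm x)\<^sup>2 \<ge> R} x * (norm x)\<^sup>2) \<partial>dmeas g) \<le> ennreal e" if e: "e > 0" for e
  proof -
    have "eventually (\<lambda>R. (SUP n. \<integral>\<^sup>+ x. indicator {x. (norm x)\<^sup>2 \<ge> R} x * ennreal ((norm x)\<^sup>2) \<partial>dmeas (gs n)) < ennreal e) at_top"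
      using order_tendstoD(2)[OF ui, of "ennreal e"] e by simp
    then have "eventually (\<lambda>R. R > 0 \<and> (SUP n. \<integral>\<^sup>+ x. indicator {x. (norm x)\<^sup>2 \<ge> R} x * ennreal ((norm x)\<^sup>2) \<partial>dmeas (gs n)) < ennreal e) at_top"
      using eventually_gt_at_top[of 0] by eventually_elim auto
    from eventually_happens[OF this] obtain R where R: "R > 0"
      "(SUP n. \<integral>\<^sup>+ x. indicator {x. (norm x)\<^sup>2 \<ge> R} x * ennreal ((norm x)\<^sup>2) \<partial>dmeas (gs n)) < ennreal e" by auto
    have eq: "indicator {x. (norm x)\<^sup>2 \<ge> R} x * ennreal ((norm x)\<^sup>2) = ennreal (indicator {x. (norm x)\<^sup>2 \<ge> R} x * (norm x)\<^sup>2)" for x :: 'a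
      by (simp add: indicator_def)
    have 1: "(\<integral>\<^sup>+x. ennreal (indicator {x. (norm x)\<^sup>2 \<ge> R} x * (norm x)\<^sup>2) \<partial>dmeas (gs n)) \<le> ennreal e" for n
      using order_trans[OF SUP_upper[of n UNIV] less_imp_le[OF R(2)]] unfolding eq by simp
    moreover have "(\<integral>\<^sup>+x. ennreal (indicator {x. (norm x)\<^sup>2 \<ge> R} x * (norm x)\<^sup>2) \<partial>dmeas g) \<le> ennreal e"
      by (rule nn_integral_dmeas_liminf_le[OF _ _ _ nonneg _ lim 1]) auto
    ultimately show ?thesis using R(1) by blast
  qed
  \<comment> \<open>Membership in \<open>in_S\<close> says nothing about moments. Finiteness is
    extracted from the tail condition at level 1, since the square is at most \<open>R\<close> plus
    its tail.\<close>
  have fin: "(\<integral>\<^sup>+x. ennreal ((norm x)\<^sup>2) \<partial>dmeas h) < \<infinity>"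
    if h: "prob_space (dmeas h)" and [measurable]: "h \<in> borel_measurable borel"
      and le: "(\<integral>\<^sup>+x. ennreal (indicator {x. (norm x)\<^sup>2 \<ge> R} x * (norm x)\<^sup>2) \<partial>dmeas h) \<le> ennreal 1" "R > 0"
    for h :: "'a \<Rightarrow> real" and R
  proof -
    have [measurable_cong]: "sets (dmeas h) = sets borel" by (simp add: dmeas_def)
    have "(\<integral>\<^sup>+x. ennreal ((norm x)\<^sup>2) \<partial>dmeas h)
        \<le> (\<integral>\<^sup>+x. ennreal R + ennreal (indicator {x. (norm x)\<^sup>2 \<ge> R} x * (norm x)\<^sup>2) \<partial>dmeas h)"
      using \<open>R > 0\<close> by (intro nn_integral_mono) (auto simp: indicator_def)
    also have "\<dots> = ennreal R + (\<integral>\<^sup>+x. ennreal (indicator {x. (norm x)\<^sup>2 \<ge> R} x * (norm x)\<^sup>2) \<partial>dmeas h)"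
      using prob_space.emeasure_space_1[OF h] by (subst nn_integral_add) auto
    also have "\<dots> < \<infinity>" using le(1) by (auto simp: less_top intro: le_less_trans)
    finally show ?thesis .
  qed
  obtain R where R: "R > 0"
    "\<And>n. (\<integral>\<^sup>+x. ennreal (indicator {x. (norm x)\<^sup>2 \<ge> R} x * (norm x)\<^sup>2) \<partial>dmeas (gs n)) \<le> ennreal 1"
    "(\<integral>\<^sup>+x. ennreal (indicator {x. (norm x)\<^sup>2 \<ge> R} x * (norm x)\<^sup>2) \<partial>dmeas g) \<le> ennreal 1"
    using tail[of 1] by auto
  have dn: "dens (gs n)" for n
    by (rule densI[OF _ nonneg(1) prob(1) fin[OF prob(1) _ R(2,1)]]) auto
  have dg: "dens g"
    by (rule densI[OF _ nonneg(2) prob(2) fin[OF prob(2) _ R(3,1)]]) auto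
  have "(\<lambda>n. \<integral>x. gs n x * (norm x)\<^sup>2 \<partial>lborel) \<longlonglongrightarrow> (\<integral>x. g x * (norm x)\<^sup>2 \<partial>lborel)"
  proof (rule LIMSEQ_I)
    fix e :: real assume e: "e > 0"
    obtain R where R: "R > 0"
      "\<And>n. (\<integral>\<^sup>+x. ennreal (indicator {x. (norm x)\<^sup>2 \<ge> R} x * (norm x)\<^sup>2) \<partial>dmeas (gs n)) \<le> ennreal (e/3)"
      "(\<integral>\<^sup>+x. ennreal (indicator {x. (norm x)\<^sup>2 \<ge> R} x * (norm x)\<^sup>2) \<partial>dmeas g) \<le> ennreal (e/3)"
      using tail[of "e/3"] e by auto
    have "bounded (range (\<lambda>x::'a. min ((norm x)\<^sup>2) R))"
      using R(1) by (intro boundedI[of _ R]) auto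
    moreover have "continuous_on UNIV (\<lambda>x::'a. min ((norm x)\<^sup>2) R)" by (intro continuous_intros)
    ultimately have "(\<lambda>n. \<integral>x. min ((norm x)\<^sup>2) R \<partial>dmeas (gs n)) \<longlonglongrightarrow> (\<integral>x. min ((norm x)\<^sup>2) R \<partial>dmeas g)"
      using weak unfolding weakly_converges_def by blast
    from LIMSEQ_D[OF this, of "e / 3"] e obtain N where
      N: "\<And>n. n \<ge> N \<Longrightarrow> \<bar>(\<integral>x. gs n x * min ((norm x)\<^sup>2) R \<partial>lborel) - (\<integral>x. g x * min ((norm x)\<^sup>2) R \<partial>lborel)\<bar> < e / 3"
      by (auto simp: integral_dmeas nonneg)
    \<comment> \<open>Truncation changes nothing where \<open>(norm x)\<^sup>2 < R\<close> and
      elsewhere removes at most \<open>(norm x)\<^sup>2\<close>.\<close>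
    have close: "\<bar>(\<integral>x. h x * (norm x)\<^sup>2 \<partial>lborel) - (\<integral>x. h x * min ((norm x)\<^sup>2) R \<partial>lborel)\<bar> \<le> e / 3"
      if h: "dens h" and le: "(\<integral>\<^sup>+x. ennreal (indicator {x. (norm x)\<^sup>2 \<ge> R} x * (norm x)\<^sup>2) \<partial>dmeas h) \<le> ennreal (e/3)"
      for h :: "'a \<Rightarrow> real"
    proof -
      have i1: "integrable lborel (\<lambda>x. h x * (norm x)\<^sup>2)"
        using dens_integrable[OF h, of "\<lambda>x. (norm x)\<^sup>2" 1] norm_sq_le_weight by auto
      have i2: "integrable lborel (\<lambda>x. h x * min ((norm x)\<^sup>2) R)"
        using dens_integrable[OF h, of "\<lambda>x. min ((norm x)\<^sup>2) R" 1] R(1) norm_sq_le_weight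
        by (auto simp: min_le_iff_disj)
      have tl: "indicat_real {x. (norm x)\<^sup>2 \<ge> R} x * (norm x)\<^sup>2 \<le> 1 * weight x" for x :: 'a
        using norm_sq_le_weight[of x] weight_nonneg[of x] by (simp add: indicator_def)
      have i3: "integrable lborel (\<lambda>x. h x * (indicator {x. (norm x)\<^sup>2 \<ge> R} x * (norm x)\<^sup>2))"
        using dens_integrable[OF h, of "\<lambda>x. indicator {x. (norm x)\<^sup>2 \<ge> R} x * (norm x)\<^sup>2" 1] tl by auto
      have "\<bar>(\<integral>x. h x * (norm x)\<^sup>2 \<partial>lborel) - (\<integral>x. h x * min ((norm x)\<^sup>2) R \<partial>lborel)\<bar>
          = norm (\<integral>x. h x * (norm x)\<^sup>2 - h x * min ((norm x)\<^sup>2) R \<partial>lborel)"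
        using i1 i2 by simp
      also have "\<dots> \<le> (\<integral>x. h x * (indicator {x. (norm x)\<^sup>2 \<ge> R} x * (norm x)\<^sup>2) \<partial>lborel)"
      proof (rule Bochner_Integration.integral_norm_bound_integral)
        fix x
        have "norm (h x * (norm x)\<^sup>2 - h x * min ((norm x)\<^sup>2) R) = h x * ((norm x)\<^sup>2 - min ((norm x)\<^sup>2) R)"
          using densD(2)[OF h, of x] by (simp flip: right_diff_distrib)
        also have "\<dots> \<le> h x * (indicator {x. (norm x)\<^sup>2 \<ge> R} x * (norm x)\<^sup>2)"
          using R(1) by (intro mult_left_mono densD(2)[OF h]) (auto simp: indicator_def)
        finally show "norm (h x * (norm x)\<^sup>2 - h x * min ((norm x)\<^sup>2) R)
          \<le> h x * (indicator {x. (norm x)\<^sup>2 \<ge> R} x * (norm x)\<^sup>2)" .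
      qed (use i1 i2 i3 in auto)
      also have "\<dots> \<le> e / 3"
        using le e by (subst (asm) nn_integral_dmeas[OF h _ _ tl]) (auto simp: ennreal_le_iff)
      finally show ?thesis .
    qed
    have "norm ((\<integral>x. gs n x * (norm x)\<^sup>2 \<partial>lborel) - (\<integral>x. g x * (norm x)\<^sup>2 \<partial>lborel)) < e" if "n \<ge> N" for n
      using N[OF that] close[OF dn R(2), of n] close[OF dg R(3)] unfolding real_norm_def by linarith
    then show "\<exists>N. \<forall>n\<ge>N. norm ((\<integral>x. gs n x * (norm x)\<^sup>2 \<partial>lborel) - (\<integral>x. g x * (norm x)\<^sup>2 \<partial>lborel)) < e" by blast
  qed
  then have "(\<lambda>n. 1 + (\<integral>x. gs n x * (norm x)\<^sup>2 \<partial>lborel)) \<longlonglongrightarrow> 1 + (\<integral>x. g x * (norm x)\<^sup>2 \<partial>lborel)"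
    by (intro tendsto_intros) auto
  moreover have "(\<integral>x. weight x * h x \<partial>lborel) = 1 + (\<integral>x. h x * (norm x)\<^sup>2 \<partial>lborel)" if h: "dens h" for h :: "'a \<Rightarrow> real"
  proof -
    have "integrable lborel (\<lambda>x. h x * (norm x)\<^sup>2)"
      using dens_integrable[OF h, of "\<lambda>x. (norm x)\<^sup>2" 1] norm_sq_le_weight by auto
    then show ?thesis using densD(3,5)[OF h] by (simp add: weight_def distrib_left mult.commute[of _ "h _"])
  qed
  ultimately show ?thesis using dn dg lim by (simp add: dconv_def)
qed

section \<open>Stability of the convergence notion and the induction invariant\<close>

lemma dconv_const: "dens g \<Longrightarrow> dconv (\<lambda>_. g) g"
  by (simp add: dconv_def)

lemma dconv_subseq:
  assumes "dconv gs g" "strict_mono r"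
  shows "dconv (\<lambda>n. gs (r n)) g"
proof -
  have 1: "AE x in lborel. (\<lambda>n. gs (r n) x) \<longlonglongrightarrow> g x"
  proof -
    have "AE x in lborel. (\<lambda>n. gs n x) \<longlonglongrightarrow> g x" using assms(1) by (simp add: dconv_def)
    then show ?thesis
      by eventually_elim (use LIMSEQ_subseq_LIMSEQ[OF _ assms(2)] in \<open>auto simp: o_def\<close>)
  qed
  have 2: "(\<lambda>n. \<integral>x. weight x * gs (r n) x \<partial>lborel) \<longlonglongrightarrow> (\<integral>x. weight x * g x \<partial>lborel)"
    using LIMSEQ_subseq_LIMSEQ[OF _ assms(2), of "\<lambda>n. \<integral>x. weight x * gs n x \<partial>lborel"] assms(1)
    by (auto simp: o_def dconv_def)
  show ?thesis using 1 2 assms(1) by (simp add: dconv_def)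
qed

text \<open>The invariant of the backward induction. The bound is linear in the weighted moment
  because that moment, taken for an updated measure and multiplied by the cell probability, is again
  an integral over the cell. It also keeps limits finite, so that products in \<open>ennreal\<close>
  converge.\<close>

definition regular :: "real \<Rightarrow> ('a::euclidean_space measure \<Rightarrow> ennreal) \<Rightarrow> bool" where
  "regular b J \<longleftrightarrow> 0 \<le> b \<and> (\<forall>g. dens g \<longrightarrow> J (dmeas g) \<le> ennreal (b * (\<integral>x. weight x * g x \<partial>lborel))) \<and>
     (\<forall>gs g. dconv gs g \<longrightarrow> (\<lambda>n. J (dmeas (gs n))) \<longlonglongrightarrow> J (dmeas g))"

section \<open>The source and its updated measures\<close>

text \<open>The initial law is left out: the induction on value functions sees only the transition
  mechanism.\<close>

locale markov_source =
  fixes f :: "'a::euclidean_space \<Rightarrow> 'a \<Rightarrow> 'a" and nu_w :: "'a measure"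
    and phi :: "'a \<Rightarrow> 'a \<Rightarrow> real" and C C1 K :: real
  assumes f_meas: "(\<lambda>(x, w). f x w) \<in> borel_measurable (borel \<Otimes>\<^sub>M borel)"
    and nu_prob: "prob_space nu_w" and nu_sets: "sets nu_w = sets borel"
    and phi_dens: "\<And>x. distr nu_w borel (f x) = density lborel (\<lambda>z. ennreal (phi x z))"
    and phi_pos: "\<And>x z. phi x z > 0"
    and phi_bdd: "\<And>x z. phi x z \<le> C"
    and phi_lip: "\<And>x. C1-lipschitz_on UNIV (phi x)"
    and K_pos: "K > 0"
    and f_growth: "\<And>x w. norm (f x w) \<le> K * (norm x + norm w)"
    and nu_moment: "(\<integral>\<^sup>+ z. ennreal ((norm z)\<^sup>2) \<partial>nu_w) < \<infinity>"
begin

sublocale nu: prob_space nu_w by (rule nu_prob)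

lemmas [measurable_cong] = nu_sets

lemma f_measurable [measurable (raw)]:
  assumes [measurable]: "g \<in> borel_measurable N" "h \<in> borel_measurable N"
  shows "(\<lambda>x. f (g x) (h x)) \<in> borel_measurable N"
proof -
  have "(\<lambda>x. (\<lambda>(x, w). f x w) (g x, h x)) \<in> borel_measurable N"
    using f_meas by (rule measurable_compose[rotated]) measurable
  then show ?thesis by simp
qed

lemma C_pos: "0 < C"
  using phi_pos phi_bdd by (rule less_le_trans)

lemma phi_measurable2 [measurable]: "phi x \<in> borel_measurable borel"
  using phi_lip by (rule lipschitz_borel_measurable)

lemma nn_integral_phi:
  assumes [measurable]: "h \<in> borel_measurable borel"
  shows "(\<integral>\<^sup>+z. ennreal (phi x z) * h z \<partial>lborel) = (\<integral>\<^sup>+w. h (f x w) \<partial>nu_w)"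
proof -
  have "(\<integral>\<^sup>+z. ennreal (phi x z) * h z \<partial>lborel) = (\<integral>\<^sup>+z. h z \<partial>distr nu_w borel (f x))"
    unfolding phi_dens by (subst nn_integral_density) auto
  also have "\<dots> = (\<integral>\<^sup>+w. h (f x w) \<partial>nu_w)"
    by (intro nn_integral_distr) auto
  finally show ?thesis .
qed

lemma integral_phi:
  fixes h :: "'a \<Rightarrow> real"
  assumes [measurable]: "h \<in> borel_measurable borel"
  shows "(\<integral>z. h z * phi x z \<partial>lborel) = (\<integral>w. h (f x w) \<partial>nu_w)"
proof -
  have "(\<integral>z. phi x z *\<^sub>R h z \<partial>lborel) = (\<integral>z. h z \<partial>distr nu_w borel (f x))"
    unfolding phi_dens by (subst integral_density) (auto intro: less_imp_le[OF phi_pos])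
  also have "\<dots> = (\<integral>w. h (f x w) \<partial>nu_w)"
    by (intro integral_distr) auto
  finally show ?thesis by (simp add: mult.commute)
qed

text \<open>Joint measurability comes from recovering the continuous density \<open>phi x\<close> as a limit of
  mollifications, which are averages over the noise.\<close>

lemma phi_measurable_pair: "(\<lambda>(x, z). phi x z) \<in> borel_measurable (borel \<Otimes>\<^sub>M borel)"
proof (rule borel_measurable_LIMSEQ_real)
  let ?r = "\<lambda>n. 1 / real (Suc n)"
  let ?A = "\<lambda>n (x, z). (\<integral>w. bump (?r n) z (f x w) \<partial>nu_w) / (\<integral>y. bump (?r n) z y \<partial>lborel)"
  show "(\<lambda>n. ?A n p) \<longlonglongrightarrow> (case p of (x, z) \<Rightarrow> phi x z)" for p :: "'a \<times> 'a"
  proof (cases p)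
    case (Pair x z)
    have bm: "bump r z \<in> borel_measurable borel" for r
      by (intro borel_measurable_continuous_onI bump_continuous)
    have le: "norm (?A n (x, z) - phi x z) \<le> C1 * ?r n" for n
      using lipschitz_mollify(3)[OF phi_lip, of "?r n" z x] integral_phi[OF bm, of "?r n" x] by simp
    have "(\<lambda>n. ?r n) \<longlonglongrightarrow> 0" using LIMSEQ_Suc[OF lim_1_over_n] by simp
    then have "(\<lambda>n. C1 * ?r n) \<longlonglongrightarrow> 0" by (rule tendsto_mult_right_zero)
    then have "(\<lambda>n. ?A n (x, z) - phi x z) \<longlonglongrightarrow> 0"
      by (rule Lim_null_comparison[OF always_eventually[OF allI[OF le]]])
    then show ?thesis unfolding Pair by (simp add: LIM_zero_iff)
  qed
  show "?A n \<in> borel_measurable (borel \<Otimes>\<^sub>M borel)" for n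
    unfolding bump_def by measurable
qed

lemma phi_measurable [measurable (raw)]:
  assumes [measurable]: "g \<in> borel_measurable N" "h \<in> borel_measurable N"
  shows "(\<lambda>x. phi (g x) (h x)) \<in> borel_measurable N"
proof -
  have "(\<lambda>x. (\<lambda>(x, z). phi x z) (g x, h x)) \<in> borel_measurable N"
    using phi_measurable_pair by (rule measurable_compose[rotated]) measurable
  then show ?thesis by simp
qed

section \<open>Growth of the second moment in one step\<close>

definition step_weight :: "'a \<Rightarrow> real" where
  "step_weight x = (\<integral>w. weight (f x w) \<partial>nu_w)"

text \<open>From \<open>(K * (norm x + norm w))\<^sup>2 \<le> 2 * K\<^sup>2 * ((norm x)\<^sup>2 +
  (norm w)\<^sup>2)\<close>: integrate over the noise, add 1, and absorb every summand into a
  multiple of \<open>weight x\<close>.\<close>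

definition growth :: real where
  "growth = 1 + 2 * K\<^sup>2 + 2 * K\<^sup>2 * (\<integral>w. (norm w)\<^sup>2 \<partial>nu_w)"

lemma growth_nonneg: "0 \<le> growth"
  by (simp add: growth_def add_nonneg_nonneg)

lemma step_weight_measurable [measurable]: "step_weight \<in> borel_measurable borel"
  unfolding step_weight_def by measurable

lemma step_weight:
  shows "(\<integral>\<^sup>+w. ennreal (weight (f x w)) \<partial>nu_w) = ennreal (step_weight x)"
    and "0 \<le> step_weight x" and "step_weight x \<le> growth * weight x"
proof -
  have sq: "integrable nu_w (\<lambda>w. (norm w)\<^sup>2)"
    using nu_moment by (intro integrableI_nonneg) auto
  have le: "weight (f x w) \<le> 1 + 2 * K\<^sup>2 * (norm x)\<^sup>2 + 2 * K\<^sup>2 * (norm w)\<^sup>2" for w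
  proof -
    have "(norm (f x w))\<^sup>2 \<le> (K * (norm x + norm w))\<^sup>2"
      by (intro power_mono f_growth) auto
    also have "\<dots> = K\<^sup>2 * (norm (norm x + norm w))\<^sup>2" by (simp add: power_mult_distrib)
    also have "\<dots> \<le> K\<^sup>2 * (2 * (norm x)\<^sup>2 + 2 * (norm w)\<^sup>2)"
      using norm_add_sq_le[of "norm x" "norm w"] by (intro mult_left_mono) auto
    finally show ?thesis by (simp add: weight_def algebra_simps)
  qed
  have int: "integrable nu_w (\<lambda>w. weight (f x w))"
  proof (rule Bochner_Integration.integrable_bound)
    show "integrable nu_w (\<lambda>w. 1 + 2 * K\<^sup>2 * (norm x)\<^sup>2 + 2 * K\<^sup>2 * (norm w)\<^sup>2)"
      using sq by simp
    have "norm (weight (f x w)) \<le> norm (1 + 2 * K\<^sup>2 * (norm x)\<^sup>2 + 2 * K\<^sup>2 * (norm w)\<^sup>2)" for w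
      using le[of w] weight_nonneg[of "f x w"] unfolding real_norm_def by linarith
    then show "AE w in nu_w. norm (weight (f x w)) \<le> norm (1 + 2 * K\<^sup>2 * (norm x)\<^sup>2 + 2 * K\<^sup>2 * (norm w)\<^sup>2)"
      by simp
  qed measurable
  then show "(\<integral>\<^sup>+w. ennreal (weight (f x w)) \<partial>nu_w) = ennreal (step_weight x)"
    unfolding step_weight_def by (intro nn_integral_eq_integral) (auto simp: weight_nonneg)
  show "0 \<le> step_weight x"
    unfolding step_weight_def by (intro integral_nonneg_AE) (auto simp: weight_nonneg)
  have "step_weight x \<le> (\<integral>w. 1 + 2 * K\<^sup>2 * (norm x)\<^sup>2 + 2 * K\<^sup>2 * (norm w)\<^sup>2 \<partial>nu_w)"
    unfolding step_weight_def using int sq le by (intro integral_mono) auto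
  also have "\<dots> = 1 + 2 * K\<^sup>2 * (norm x)\<^sup>2 + 2 * K\<^sup>2 * (\<integral>w. (norm w)\<^sup>2 \<partial>nu_w)"
    using sq by (simp add: nu.prob_space)
  also have "\<dots> \<le> growth * weight x"
    by (simp add: growth_def weight_def algebra_simps)
  finally show "step_weight x \<le> growth * weight x" .
qed

section \<open>Densities and second moments of the updated measures\<close>

definition post_density :: "'a set \<Rightarrow> ('a \<Rightarrow> real) \<Rightarrow> 'a \<Rightarrow> real" where
  "post_density A g z = (\<integral>x. g x * (indicator A x * phi x z) \<partial>lborel) / (\<integral>x. g x * indicator A x \<partial>lborel)"

lemma nn_integral_indicator_phi:
  assumes g: "dens g" and [measurable]: "A \<in> sets borel"
  shows "(\<integral>\<^sup>+x. ennreal (indicator A x * phi x z) \<partial>dmeas g) = ennreal (\<integral>x. g x * (indicator A x * phi x z) \<partial>lborel)"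
proof (rule nn_integral_dmeas[OF g])
  show "indicator A x * phi x z \<le> C * weight x" for x
    using mult_mono[OF phi_bdd[of x z] weight_ge_1[of x]] C_pos less_imp_le[OF phi_pos[of x z]] weight_nonneg[of x]
    by (auto simp: indicator_def)
qed (auto intro: mult_nonneg_nonneg less_imp_le[OF phi_pos])

lemma post_dmeas:
  assumes g: "dens g" and Q: "Q \<in> Qc M" and pos: "0 < (\<integral>x. g x * indicator (Q -` {m}) x \<partial>lborel)"
  shows "post phi m (dmeas g) Q = dmeas (post_density (Q -` {m}) g)"
proof -
  note [measurable] = Qc_cell_measurable[OF Q]
  have "(\<integral>\<^sup>+x. indicator (Q -` {m}) x * ennreal (phi x z) \<partial>dmeas g)
      = (\<integral>\<^sup>+x. ennreal (indicator (Q -` {m}) x * phi x z) \<partial>dmeas g)" for z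
    by (intro nn_integral_cong) (auto simp: indicator_def)
  then have "(\<integral>\<^sup>+x. indicator (Q -` {m}) x * ennreal (phi x z) \<partial>dmeas g) / emeasure (dmeas g) (Q -` {m})
      = ennreal (post_density (Q -` {m}) g z)" for z
    unfolding post_density_def emeasure_dmeas[OF g Qc_cell_measurable[OF Q]]
    using pos densD(2)[OF g] less_imp_le[OF phi_pos]
    by (subst divide_ennreal[symmetric])
      (auto simp: nn_integral_indicator_phi[OF g Qc_cell_measurable[OF Q]] intro!: integral_nonneg_AE)
  then show ?thesis unfolding post_def dmeas_def[of "post_density _ _"] by simp
qed

text \<open>By Tonelli the integral over \<open>z\<close> is done first and becomes an average over
  the noise. \<open>F = 1\<close> will give total mass 1, and \<open>F = weight\<close> the weighted
  moment.\<close>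

lemma nn_integral_post_density:
  assumes g: "dens g" and [measurable]: "A \<in> sets borel" "F \<in> borel_measurable borel"
    and pos: "0 < (\<integral>x. g x * indicator A x \<partial>lborel)" and F: "\<And>z. 0 \<le> F z"
  shows "(\<integral>\<^sup>+z. ennreal (F z * post_density A g z) \<partial>lborel) =
    (\<integral>\<^sup>+x. ennreal (g x * indicator A x) * (\<integral>\<^sup>+w. ennreal (F (f x w)) \<partial>nu_w) \<partial>lborel)
      / ennreal (\<integral>x. g x * indicator A x \<partial>lborel)"
proof -
  note [measurable] = densD(1)[OF g]
  define c where "c = (\<integral>x. g x * indicator A x \<partial>lborel)"
  have g0: "0 \<le> g x" for x by (rule densD(2)[OF g])
  have "ennreal (F z * post_density A g z)
      = (\<integral>\<^sup>+x. ennreal (F z) * (ennreal (g x * indicator A x) * ennreal (phi x z)) \<partial>lborel) / ennreal c" for z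
  proof -
    have "ennreal (F z * post_density A g z) = ennreal (F z) * ennreal (\<integral>x. g x * (indicator A x * phi x z) \<partial>lborel) / ennreal c"
      unfolding post_density_def c_def[symmetric] using F pos g0 less_imp_le[OF phi_pos]
      by (subst ennreal_times_divide[symmetric], subst divide_ennreal)
        (auto simp: c_def ennreal_mult'[symmetric] intro!: integral_nonneg_AE)
    also have "ennreal (\<integral>x. g x * (indicator A x * phi x z) \<partial>lborel) = (\<integral>\<^sup>+x. ennreal (g x * indicator A x) * ennreal (phi x z) \<partial>lborel)"
      unfolding nn_integral_indicator_phi[OF g \<open>A \<in> sets borel\<close>, symmetric] dmeas_def
      by (subst nn_integral_density) (auto simp: ennreal_mult[symmetric] g0 less_imp_le[OF phi_pos] mult.assoc)
    finally show ?thesis by (simp add: nn_integral_cmult)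
  qed
  then have "(\<integral>\<^sup>+z. ennreal (F z * post_density A g z) \<partial>lborel)
      = (\<integral>\<^sup>+z. (\<integral>\<^sup>+x. ennreal (F z) * (ennreal (g x * indicator A x) * ennreal (phi x z)) \<partial>lborel) / ennreal c \<partial>lborel)"
    by simp
  also have "\<dots> = (\<integral>\<^sup>+z. (\<integral>\<^sup>+x. ennreal (F z) * (ennreal (g x * indicator A x) * ennreal (phi x z)) \<partial>lborel) \<partial>lborel) / ennreal c"
    by (subst nn_integral_divide) auto
  \<comment> \<open>The exchange rests on joint measurability of \<open>phi\<close>.\<close>
  also have "(\<integral>\<^sup>+z. (\<integral>\<^sup>+x. ennreal (F z) * (ennreal (g x * indicator A x) * ennreal (phi x z)) \<partial>lborel) \<partial>lborel)
      = (\<integral>\<^sup>+x. (\<integral>\<^sup>+z. ennreal (F z) * (ennreal (g x * indicator A x) * ennreal (phi x z)) \<partial>lborel) \<partial>lborel)"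
    by (rule lborel_pair.Fubini') measurable
  also have "\<dots> = (\<integral>\<^sup>+x. ennreal (g x * indicator A x) * (\<integral>\<^sup>+z. ennreal (phi x z) * ennreal (F z) \<partial>lborel) \<partial>lborel)"
    by (intro nn_integral_cong, subst nn_integral_cmult[symmetric]) (auto simp: mult_ac)
  also have "\<dots> = (\<integral>\<^sup>+x. ennreal (g x * indicator A x) * (\<integral>\<^sup>+w. ennreal (F (f x w)) \<partial>nu_w) \<partial>lborel)"
    by (subst nn_integral_phi) auto
  finally show ?thesis by (simp add: c_def)
qed

lemma integrable_step_weight:
  assumes g: "dens g" and [measurable]: "A \<in> sets borel"
  shows "integrable lborel (\<lambda>x. g x * (indicator A x * step_weight x))"
proof -
  have "norm (indicator A x * step_weight x) \<le> growth * weight x" for x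
    using step_weight[of x] by (auto simp: indicator_def intro: mult_nonneg_nonneg growth_nonneg weight_nonneg)
  then show ?thesis using dens_integrable[OF g, of "\<lambda>x. indicator A x * step_weight x" growth] by simp
qed

lemma dens_post_density:
  assumes g: "dens g" and A [measurable]: "A \<in> sets borel"
    and pos: "0 < (\<integral>x. g x * indicator A x \<partial>lborel)"
  shows "dens (post_density A g)"
    and "(\<integral>z. weight z * post_density A g z \<partial>lborel) =
      (\<integral>x. g x * (indicator A x * step_weight x) \<partial>lborel) / (\<integral>x. g x * indicator A x \<partial>lborel)"
proof -
  note [measurable] = densD(1)[OF g]
  define c where "c = (\<integral>x. g x * indicator A x \<partial>lborel)"
  have c: "c > 0" using pos by (simp add: c_def)
  have g0: "0 \<le> g x" for x by (rule densD(2)[OF g])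
  have nonneg: "0 \<le> post_density A g z" for z
    unfolding post_density_def using pos g0 less_imp_le[OF phi_pos]
    by (auto intro!: divide_nonneg_pos integral_nonneg_AE)
  have [measurable]: "post_density A g \<in> borel_measurable borel"
    unfolding post_density_def by measurable
  have w: "(\<integral>\<^sup>+z. ennreal (weight z * post_density A g z) \<partial>lborel) = ennreal ((\<integral>x. g x * (indicator A x * step_weight x) \<partial>lborel) / c)"
  proof -
    have "(\<integral>\<^sup>+x. ennreal (g x * indicator A x) * (\<integral>\<^sup>+w. ennreal (weight (f x w)) \<partial>nu_w) \<partial>lborel)
        = (\<integral>\<^sup>+x. ennreal (g x * (indicator A x * step_weight x)) \<partial>lborel)"
      using g0 step_weight(2) by (intro nn_integral_cong) (simp add: step_weight(1) ennreal_mult[symmetric] mult.assoc)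
    also have "\<dots> = ennreal (\<integral>x. g x * (indicator A x * step_weight x) \<partial>lborel)"
      using g0 step_weight(2) by (intro nn_integral_eq_integral integrable_step_weight[OF g A]) auto
    finally show ?thesis
      using nn_integral_post_density[OF g A weight_measurable pos weight_nonneg] c g0 step_weight(2)
      by (simp add: c_def divide_ennreal integral_nonneg_AE)
  qed
  have nnw: "0 \<le> weight z * post_density A g z" for z
    using nonneg weight_nonneg[of z] by simp
  have int: "integrable lborel (\<lambda>z. weight z * post_density A g z)"
    using w nnw by (intro integrableI_nonneg) auto
  show "(\<integral>z. weight z * post_density A g z \<partial>lborel) =
      (\<integral>x. g x * (indicator A x * step_weight x) \<partial>lborel) / (\<integral>x. g x * indicator A x \<partial>lborel)"
    using w nnw c g0 step_weight(2)
    by (subst integral_eq_nn_integral) (auto simp: c_def intro!: divide_nonneg_nonneg integral_nonneg_AE)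
  have ic: "integrable lborel (\<lambda>x. g x * indicator A x)"
    using dens_integrable[OF g, of "indicat_real A" 1] by (simp add: indicator_le_weight)
  have "(\<integral>\<^sup>+z. ennreal (1 * post_density A g z) \<partial>lborel) = ennreal c / ennreal c"
    using nn_integral_post_density[OF g A _ pos, of "\<lambda>_. 1"] ic g0
    by (simp add: nu.emeasure_space_1 c_def nn_integral_eq_integral)
  also have "\<dots> = 1" using c by (simp add: divide_ennreal)
  finally have "(\<integral>z. post_density A g z \<partial>lborel) = 1"
    using nonneg by (subst integral_eq_nn_integral) auto
  then show "dens (post_density A g)" using nonneg int by (simp add: dens_def)
qed

text \<open>For fixed \<open>z\<close>, boundedness and measurability of \<open>phi x z\<close> in
  \<open>x\<close> suffice for convergence of the numerator. The moments converge because
  \<open>step_weight\<close> is likewise dominated by a multiple of \<open>weight\<close>.\<close>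

lemma dconv_post_density:
  assumes d: "dconv gs g" and m [measurable]: "\<And>n. As n \<in> sets borel" "A \<in> sets borel"
    and lim: "AE x in lborel. eventually (\<lambda>n. x \<in> As n \<longleftrightarrow> x \<in> A) sequentially"
    and pos: "\<And>n. 0 < (\<integral>x. gs n x * indicator (As n) x \<partial>lborel)" "0 < (\<integral>x. g x * indicator A x \<partial>lborel)"
  shows "dconv (\<lambda>n. post_density (As n) (gs n)) (post_density A g)"
proof -
  have dn: "dens (gs n)" and dg: "dens g" for n using d by (auto simp: dconv_def)
  have c: "(\<lambda>n. \<integral>x. gs n x * indicator (As n) x \<partial>lborel) \<longlonglongrightarrow> (\<integral>x. g x * indicator A x \<partial>lborel)"
    using dconv_cell_integral_tendsto[OF d m _ _ lim, of "\<lambda>x. 1::real" 1] weight_ge_1 by auto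
  have s: "(\<lambda>n. \<integral>x. gs n x * (indicator (As n) x * step_weight x) \<partial>lborel) \<longlonglongrightarrow>
      (\<integral>x. g x * (indicator A x * step_weight x) \<partial>lborel)"
    using dconv_cell_integral_tendsto[OF d m _ _ lim, of step_weight growth] step_weight by auto
  have p: "(\<lambda>n. \<integral>x. gs n x * (indicator (As n) x * phi x z) \<partial>lborel) \<longlonglongrightarrow>
      (\<integral>x. g x * (indicator A x * phi x z) \<partial>lborel)" for z
  proof -
    have "norm (phi x z) \<le> C * weight x" for x
      using mult_mono[OF phi_bdd[of x z] weight_ge_1[of x]] C_pos less_imp_le[OF phi_pos[of x z]] by simp
    then show ?thesis
      using dconv_cell_integral_tendsto[OF d m _ _ lim, of "\<lambda>x. phi x z" C] by auto
  qed
  have "(\<lambda>n. post_density (As n) (gs n) z) \<longlonglongrightarrow> post_density A g z" for z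
    unfolding post_density_def using pos(2) by (intro tendsto_divide p c) auto
  moreover have "(\<lambda>n. \<integral>z. weight z * post_density (As n) (gs n) z \<partial>lborel) \<longlonglongrightarrow> (\<integral>z. weight z * post_density A g z \<partial>lborel)"
    unfolding dens_post_density(2)[OF dn m(1) pos(1)] dens_post_density(2)[OF dg m(2) pos(2)]
    using pos(2) by (intro tendsto_divide s c) auto
  ultimately show ?thesis
    using dens_post_density(1)[OF dn m(1) pos(1)] dens_post_density(1)[OF dg m(2) pos(2)]
    by (simp add: dconv_def)
qed

end

section \<open>Dynamic programming\<close>

lemma const_one_in_Qc: "M \<ge> 1 \<Longrightarrow> (\<lambda>_. 1) \<in> Qc M"
  by (auto simp: Qc_def vimage_def)

lemma tendsto_mult_ennreal_finite:
  fixes a b :: ennreal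
  assumes "(u \<longlongrightarrow> a) F" "(v \<longlongrightarrow> b) F" "a < \<infinity>" "b < \<infinity>"
  shows "((\<lambda>n. u n * v n) \<longlongrightarrow> a * b) F"
  using assms by (intro tendsto_mult_ennreal) auto

context markov_source
begin

text \<open>The cell probability cancels the denominator in the moment of the updated measure. What
  remains is an integral over the cell, which becomes small as the cell loses its mass.\<close>

lemma post_term_le:
  assumes J: "regular b J" and g: "dens g" and Q: "Q \<in> Qc M"
  shows "J (post phi m (dmeas g) Q) * emeasure (dmeas g) (Q -` {m})
    \<le> ennreal (b * (\<integral>x. g x * (indicator (Q -` {m}) x * step_weight x) \<partial>lborel))"
proof -
  let ?A = "Q -` {m}"
  define c where "c = (\<integral>x. g x * indicator ?A x \<partial>lborel)"
  define s where "s = (\<integral>x. g x * (indicator ?A x * step_weight x) \<partial>lborel)"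
  note A = Qc_cell_measurable[OF Q, of "{m}"]
  have b: "0 \<le> b" using J by (simp add: regular_def)
  have em: "emeasure (dmeas g) ?A = ennreal c" unfolding c_def by (rule emeasure_dmeas[OF g A])
  have s0: "0 \<le> s" unfolding s_def using densD(2)[OF g] step_weight(2) by (auto intro!: integral_nonneg_AE)
  show ?thesis
  proof (cases "c > 0")
    case True
    note pos = True[unfolded c_def]
    have "J (dmeas (post_density ?A g)) \<le> ennreal (b * (\<integral>x. weight x * post_density ?A g x \<partial>lborel))"
      using J dens_post_density(1)[OF g A pos] unfolding regular_def by blast
    then have "J (post phi m (dmeas g) Q) \<le> ennreal (b * (s / c))"
      unfolding post_dmeas[OF g Q pos] dens_post_density(2)[OF g A pos] s_def c_def .
    then have "J (post phi m (dmeas g) Q) * emeasure (dmeas g) ?A \<le> ennreal (b * (s / c)) * ennreal c"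
      unfolding em by (rule mult_right_mono) simp
    also have "\<dots> = ennreal (b * s)" using True b s0 by (simp add: ennreal_mult[symmetric])
    finally show ?thesis by (simp add: s_def)
  next
    case False
    then show ?thesis by (simp add: em ennreal_neg)
  qed
qed

lemma post_term_tendsto:
  assumes J: "regular b J" and d: "dconv gs g" and Q: "\<And>n. Qs n \<in> Qc M" "Q \<in> Qc M"
    and lim: "AE x in lborel. eventually (\<lambda>n. Qs n x = Q x) sequentially"
  shows "(\<lambda>n. J (post phi m (dmeas (gs n)) (Qs n)) * emeasure (dmeas (gs n)) (Qs n -` {m}))
    \<longlonglongrightarrow> J (post phi m (dmeas g) Q) * emeasure (dmeas g) (Q -` {m})"
proof -
  have dn: "dens (gs n)" and dg: "dens g" for n using d by (auto simp: dconv_def)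
  have limA: "AE x in lborel. eventually (\<lambda>n. x \<in> Qs n -` {m} \<longleftrightarrow> x \<in> Q -` {m}) sequentially"
    using lim by eventually_elim (auto elim: eventually_mono)
  note mA = Qc_cell_measurable[OF Q(1), of _ "{m}"] Qc_cell_measurable[OF Q(2), of "{m}"]
  have c: "(\<lambda>n. \<integral>x. gs n x * indicator (Qs n -` {m}) x \<partial>lborel) \<longlonglongrightarrow> (\<integral>x. g x * indicator (Q -` {m}) x \<partial>lborel)"
    using dconv_cell_integral_tendsto[OF d mA _ _ limA, of "\<lambda>x. 1::real" 1] weight_ge_1 by auto
  have c0: "0 \<le> (\<integral>x. g x * indicator (Q -` {m}) x \<partial>lborel)"
    using densD(2)[OF dg] by (intro integral_nonneg_AE) auto
  show ?thesis
  proof (cases "(\<integral>x. g x * indicator (Q -` {m}) x \<partial>lborel) = 0")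
    case True
    \<comment> \<open>With a null limit cell the updated measures need not converge; the whole term
      is squeezed to 0 instead.\<close>
    have s: "(\<lambda>n. \<integral>x. gs n x * (indicator (Qs n -` {m}) x * step_weight x) \<partial>lborel) \<longlonglongrightarrow> 0"
      using dconv_cell_integral_tendsto[OF d mA _ _ limA, of step_weight growth] step_weight
        dens_null_cell[OF dg mA(2) True, of step_weight] by auto
    have "(\<lambda>n. ennreal (b * (\<integral>x. gs n x * (indicator (Qs n -` {m}) x * step_weight x) \<partial>lborel))) \<longlonglongrightarrow> ennreal (b * 0)"
      by (intro tendsto_ennrealI tendsto_intros s)
    then have l0: "(\<lambda>n. ennreal (b * (\<integral>x. gs n x * (indicator (Qs n -` {m}) x * step_weight x) \<partial>lborel))) \<longlonglongrightarrow> 0"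
      by simp
    have "(\<lambda>n. J (post phi m (dmeas (gs n)) (Qs n)) * emeasure (dmeas (gs n)) (Qs n -` {m})) \<longlonglongrightarrow> 0"
      by (rule tendsto_sandwich[OF _ always_eventually[OF allI[OF post_term_le[OF J dn Q(1)]]] tendsto_const l0]) simp
    then show ?thesis by (simp add: emeasure_dmeas[OF dg mA(2)] True)
  next
    case False
    then have pos: "0 < (\<integral>x. g x * indicator (Q -` {m}) x \<partial>lborel)" using c0 by simp
    then have "eventually (\<lambda>n. 0 < (\<integral>x. gs n x * indicator (Qs n -` {m}) x \<partial>lborel)) sequentially"
      using c by (rule order_tendstoD(1)[rotated])
    then obtain N where N: "\<And>n. n \<ge> N \<Longrightarrow> 0 < (\<integral>x. gs n x * indicator (Qs n -` {m}) x \<partial>lborel)"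
      by (auto simp: eventually_sequentially)
    \<comment> \<open>The first cells may have probability 0, and then there is no updated density;
      convergence is proved for the shifted sequence.\<close>
    have "dconv (\<lambda>n. gs (n + N)) g" by (rule dconv_subseq[OF d]) (simp add: strict_mono_def)
    moreover have "AE x in lborel. eventually (\<lambda>n. x \<in> Qs (n + N) -` {m} \<longleftrightarrow> x \<in> Q -` {m}) sequentially"
      using limA by eventually_elim (rule sequentially_offset)
    ultimately have "dconv (\<lambda>n. post_density (Qs (n + N) -` {m}) (gs (n + N))) (post_density (Q -` {m}) g)"
      by (intro dconv_post_density mA pos N) auto
    then have "(\<lambda>n. J (dmeas (post_density (Qs (n + N) -` {m}) (gs (n + N))))) \<longlonglongrightarrow> J (dmeas (post_density (Q -` {m}) g))"
      using J by (auto simp: regular_def)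
    then have "(\<lambda>n. J (post phi m (dmeas (gs (n + N))) (Qs (n + N)))) \<longlonglongrightarrow> J (post phi m (dmeas g) Q)"
      by (simp add: post_dmeas[OF dn Q(1) N] post_dmeas[OF dg Q(2) pos])
    then have Jlim: "(\<lambda>n. J (post phi m (dmeas (gs n)) (Qs n))) \<longlonglongrightarrow> J (post phi m (dmeas g) Q)"
      by (rule LIMSEQ_offset)
    \<comment> \<open>Multiplication in \<open>ennreal\<close> is discontinuous at infinity times 0,
      so the limit value must be known to be finite.\<close>
    have fin: "J (post phi m (dmeas g) Q) < \<infinity>"
    proof -
      have "J (dmeas (post_density (Q -` {m}) g)) \<le> ennreal (b * (\<integral>x. weight x * post_density (Q -` {m}) g x \<partial>lborel))"
        using J dens_post_density(1)[OF dg mA(2) pos] unfolding regular_def by blast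
      then show ?thesis by (simp add: post_dmeas[OF dg Q(2) pos] le_less_trans)
    qed
    show ?thesis
      unfolding emeasure_dmeas[OF dg mA(2)] emeasure_dmeas[OF dn mA(1)]
      by (intro tendsto_mult_ennreal_finite Jlim fin tendsto_ennrealI c) auto
  qed
qed

lemma objective_tendsto:
  assumes J: "regular b J" and d: "dconv gs g" and Q: "\<And>n. Qs n \<in> Qc M" "Q \<in> Qc M" and T: "T \<ge> 1"
    and lim: "AE x in lborel. eventually (\<lambda>n. Qs n x = Q x) sequentially"
  shows "(\<lambda>n. objective T M phi J (dmeas (gs n)) (Qs n)) \<longlonglongrightarrow> objective T M phi J (dmeas g) Q"
proof -
  have dg: "dens g" using d by (simp add: dconv_def)
  have "(\<lambda>n. qcost M (dmeas (gs n)) (Qs n) * inverse (of_nat T)) \<longlonglongrightarrow> qcost M (dmeas g) Q * inverse (of_nat T)"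
    using T by (intro tendsto_mult_ennreal_finite qcost_tendsto[OF d Q lim] tendsto_const)
      (auto simp: qcost_dmeas[OF dg Q(2)] less_top[symmetric])
  then show ?thesis
    unfolding objective_def divide_ennreal_def
    by (intro tendsto_add tendsto_sum post_term_tendsto[OF J d Q lim])
qed

text \<open>The direct method: a minimizing sequence has an almost everywhere convergent
  subsequence, and the objective for the fixed measure passes to the limit along it.\<close>

lemma objective_attained:
  assumes J: "regular b J" and g: "dens g" and M: "M \<ge> 1" and T: "T \<ge> 1"
  shows "\<exists>Q\<in>Qc M. (INF Q\<in>Qc M. objective T M phi J (dmeas g) Q) = objective T M phi J (dmeas g) Q"
proof -
  let ?F = "objective T M phi J (dmeas g)"
  have "?F ` Qc M \<noteq> {}" using const_one_in_Qc[OF M] by auto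
  from Inf_as_limit[OF this] obtain u where u: "\<And>n. u n \<in> ?F ` Qc M" "u \<longlonglongrightarrow> (INF Q\<in>Qc M. ?F Q)"
    by auto
  have "\<forall>n. \<exists>Q. Q \<in> Qc M \<and> u n = ?F Q" using u(1) by blast
  from choice[OF this] obtain Qs where Qs: "\<And>n. Qs n \<in> Qc M" "\<And>n. u n = ?F (Qs n)" by blast
  obtain r Q where r: "strict_mono r" and Q: "Q \<in> Qc M"
    and lim: "AE x in lborel. eventually (\<lambda>n. Qs (r n) x = Q x) sequentially"
    by (rule Qc_sequentially_compact[OF Qs(1)])
  have "(\<lambda>n. ?F (Qs (r n))) \<longlonglongrightarrow> ?F Q"
    by (rule objective_tendsto[OF J dconv_const[OF g] Qs(1) Q T lim])
  moreover have "(\<lambda>n. ?F (Qs (r n))) \<longlonglongrightarrow> (INF Q\<in>Qc M. ?F Q)"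
    using LIMSEQ_subseq_LIMSEQ[OF u(2) r] by (simp add: o_def Qs(2))
  ultimately show ?thesis using Q LIMSEQ_unique by blast
qed

text \<open>The constant counts \<open>M\<close> cells, each contributing at most one full weighted
  moment to the cost (with \<open>1 / T \<le> 1\<close>) and at most \<open>b * growth\<close> such
  moments to the continuation.\<close>

lemma objective_le:
  assumes J: "regular b J" and g: "dens g" and Q: "Q \<in> Qc M" and T: "T \<ge> 1"
  shows "objective T M phi J (dmeas g) Q \<le> ennreal (real M * (1 + b * growth) * (\<integral>x. weight x * g x \<partial>lborel))"
proof -
  define I where "I = (\<integral>x. weight x * g x \<partial>lborel)"
  have b: "0 \<le> b" using J by (simp add: regular_def)
  have g0: "0 \<le> g x" for x by (rule densD(2)[OF g])
  have I0: "0 \<le> I" unfolding I_def by (intro integral_nonneg_AE AE_I2 mult_nonneg_nonneg g0 weight_nonneg)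
  note A = Qc_cell_measurable[OF Q]
  have 1: "cell_cost g (Q -` {i}) \<le> I" for i
  proof -
    have "cell_cost g (Q -` {i}) \<le> (\<integral>x. g x * (indicator (Q -` {i}) x * (norm x)\<^sup>2) \<partial>lborel)"
      unfolding cell_cost_def using g0 by (auto intro!: divide_nonneg_nonneg integral_nonneg_AE)
    also have "\<dots> \<le> I" unfolding I_def
    proof (rule integral_mono')
      fix x
      have "indicator (Q -` {i}) x * (norm x)\<^sup>2 \<le> weight x"
        using norm_sq_le_weight[of x] weight_nonneg[of x] by (simp add: indicator_def)
      from mult_left_mono[OF this g0] show "g x * (indicator (Q -` {i}) x * (norm x)\<^sup>2) \<le> weight x * g x"
        by (simp add: mult.commute)
    qed (use densD(4)[OF g] g0 weight_nonneg in \<open>auto intro: mult_nonneg_nonneg\<close>)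
    finally show ?thesis .
  qed
  have 2: "(\<integral>x. g x * (indicator (Q -` {i}) x * step_weight x) \<partial>lborel) \<le> growth * I" for i
  proof -
    have "(\<integral>x. g x * (indicator (Q -` {i}) x * step_weight x) \<partial>lborel) \<le> (\<integral>x. growth * (weight x * g x) \<partial>lborel)"
    proof (rule integral_mono')
      fix x
      have "indicator (Q -` {i}) x * step_weight x \<le> growth * weight x"
        using step_weight[of x] by (auto simp: indicator_def intro: mult_nonneg_nonneg growth_nonneg weight_nonneg)
      from mult_left_mono[OF this g0] show "g x * (indicator (Q -` {i}) x * step_weight x) \<le> growth * (weight x * g x)"
        by (simp add: mult_ac)
    qed (use densD(4)[OF g] g0 weight_nonneg growth_nonneg in \<open>auto intro: mult_nonneg_nonneg\<close>)
    then show ?thesis by (simp add: I_def)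
  qed
  have "qcost M (dmeas g) Q / of_nat T = ennreal ((\<Sum>i=1..M. cell_cost g (Q -` {i})) / real T)"
    unfolding qcost_dmeas[OF g Q] ennreal_of_nat_eq_real_of_nat
    using T INF_cell_cost(2)[OF g A] by (intro divide_ennreal sum_nonneg) auto
  also have "\<dots> \<le> ennreal (\<Sum>i=1..M. cell_cost g (Q -` {i}))"
  proof (rule ennreal_leI)
    have "0 \<le> (\<Sum>i=1..M. cell_cost g (Q -` {i}))"
      by (intro sum_nonneg INF_cell_cost(2)[OF g A])
    from mult_left_mono[OF _ this, of 1 "real T"] T
    show "(\<Sum>i=1..M. cell_cost g (Q -` {i})) / real T \<le> (\<Sum>i=1..M. cell_cost g (Q -` {i}))"
      by (simp add: divide_le_eq)
  qed
  also have "\<dots> \<le> ennreal (\<Sum>i=1..M. I)" by (intro ennreal_leI sum_mono 1)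
  finally have q: "qcost M (dmeas g) Q / of_nat T \<le> ennreal (real M * I)" by simp
  have "(\<Sum>m=1..M. J (post phi m (dmeas g) Q) * emeasure (dmeas g) (Q -` {m})) \<le> (\<Sum>m=1..M. ennreal (b * (growth * I)))"
    using b by (intro sum_mono order_trans[OF post_term_le[OF J g Q]] ennreal_leI mult_left_mono 2)
  also have "\<dots> = ennreal (\<Sum>m=1..M. b * (growth * I))"
    using b growth_nonneg I0 by (intro sum_ennreal) auto
  finally have p: "(\<Sum>m=1..M. J (post phi m (dmeas g) Q) * emeasure (dmeas g) (Q -` {m})) \<le> ennreal (real M * (b * (growth * I)))"
    by simp
  have "objective T M phi J (dmeas g) Q \<le> ennreal (real M * I) + ennreal (real M * (b * (growth * I)))"
    unfolding objective_def by (rule add_mono[OF q p])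
  also have "\<dots> = ennreal (real M * (1 + b * growth) * I)"
    using b growth_nonneg I0 by (simp add: ennreal_plus[symmetric] algebra_simps del: ennreal_plus)
  finally show ?thesis by (simp add: I_def)
qed

lemma regular_INF_objective:
  assumes J: "regular b J" and M: "M \<ge> 1" and T: "T \<ge> 1"
  shows "regular (real M * (1 + b * growth)) (\<lambda>\<pi>. INF Q\<in>Qc M. objective T M phi J \<pi> Q)"
  unfolding regular_def
proof (intro conjI allI impI)
  show "0 \<le> real M * (1 + b * growth)"
    using J growth_nonneg by (simp add: regular_def)
  show "(INF Q\<in>Qc M. objective T M phi J (dmeas g) Q) \<le> ennreal (real M * (1 + b * growth) * (\<integral>x. weight x * g x \<partial>lborel))"
    if "dens g" for g
    by (rule INF_lower2, rule const_one_in_Qc[OF M], rule objective_le[OF J that const_one_in_Qc[OF M] T])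
  fix gs :: "nat \<Rightarrow> 'a \<Rightarrow> real" and g
  assume d: "dconv gs g"
  then have dn: "dens (gs n)" and dg: "dens g" for n by (auto simp: dconv_def)
  let ?F = "objective T M phi J"
  obtain Q0 where Q0: "Q0 \<in> Qc M" "(INF Q\<in>Qc M. ?F (dmeas g) Q) = ?F (dmeas g) Q0"
    using objective_attained[OF J dg M T] by blast
  have "\<forall>n. \<exists>Q. Q \<in> Qc M \<and> (INF Q\<in>Qc M. ?F (dmeas (gs n)) Q) = ?F (dmeas (gs n)) Q"
    using objective_attained[OF J dn M T] by blast
  from choice[OF this] obtain Qs where Qs: "\<And>n. Qs n \<in> Qc M"
    "\<And>n. (INF Q\<in>Qc M. ?F (dmeas (gs n)) Q) = ?F (dmeas (gs n)) (Qs n)" by blast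
  show "(\<lambda>n. INF Q\<in>Qc M. ?F (dmeas (gs n)) Q) \<longlonglongrightarrow> (INF Q\<in>Qc M. ?F (dmeas g) Q)"
  proof (rule order_tendstoI)
    \<comment> \<open>Upper half: the minimizer \<open>Q0\<close> for the limit measure is a
      competitor for every \<open>gs n\<close>.\<close>
    fix a assume a: "(INF Q\<in>Qc M. ?F (dmeas g) Q) < a"
    have "(\<lambda>n. ?F (dmeas (gs n)) Q0) \<longlonglongrightarrow> ?F (dmeas g) Q0"
      by (rule objective_tendsto[OF J d Q0(1) Q0(1) T]) simp
    then have "eventually (\<lambda>n. ?F (dmeas (gs n)) Q0 < a) sequentially"
      using a unfolding Q0(2) by (rule order_tendstoD)
    then show "eventually (\<lambda>n. (INF Q\<in>Qc M. ?F (dmeas (gs n)) Q) < a) sequentially"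
      by eventually_elim (rule le_less_trans[OF INF_lower[OF Q0(1)]])
  next
    fix a assume a: "a < (INF Q\<in>Qc M. ?F (dmeas g) Q)"
    show "eventually (\<lambda>n. a < (INF Q\<in>Qc M. ?F (dmeas (gs n)) Q)) sequentially"
    \<comment> \<open>Lower half: otherwise minimizers along a subsequence have values at most
      \<open>a\<close>; their almost everywhere limit would have value at most \<open>a\<close> for
      the limit measure.\<close>
    proof (rule ccontr)
      assume "\<not> ?thesis"
      then have "infinite {n. ?F (dmeas (gs n)) (Qs n) \<le> a}"
        unfolding Qs(2) by (auto simp: eventually_sequentially infinite_nat_iff_unbounded_le not_less)
      from infinite_enumerate[OF this] obtain r :: "nat \<Rightarrow> nat"
        where r: "strict_mono r" "\<And>n. ?F (dmeas (gs (r n))) (Qs (r n)) \<le> a" by blast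
      obtain r' Q where r': "strict_mono r'" and Q: "Q \<in> Qc M"
        and lim: "AE x in lborel. eventually (\<lambda>n. Qs (r (r' n)) x = Q x) sequentially"
        using Qc_sequentially_compact[of "\<lambda>n. Qs (r n)" M] Qs(1) by blast
      have "dconv (\<lambda>n. gs (r (r' n))) g" by (intro dconv_subseq[OF dconv_subseq[OF d r(1)] r'])
      then have "(\<lambda>n. ?F (dmeas (gs (r (r' n)))) (Qs (r (r' n)))) \<longlonglongrightarrow> ?F (dmeas g) Q"
        by (rule objective_tendsto[OF J _ Qs(1) Q T lim])
      then have "?F (dmeas g) Q \<le> a" by (rule LIMSEQ_le_const2) (use r(2) in auto)
      moreover have "(INF Q\<in>Qc M. ?F (dmeas g) Q) \<le> ?F (dmeas g) Q" by (rule INF_lower[OF Q])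
      ultimately show False using a by simp
    qed
  qed
qed

lemma regular_Jaux:
  assumes M: "M \<ge> 1" and T: "T \<ge> 1"
  shows "\<exists>b. regular b (Jaux T M phi k)"
proof (induction k)
  case 0
  have "regular 0 (Jaux T M phi 0)" by (simp add: regular_def)
  then show ?case ..
next
  case (Suc k)
  then obtain b where "regular b (Jaux T M phi k)" ..
  from regular_INF_objective[OF this M T] show ?case by (auto simp: regular_def)
qed

end

section \<open>Measures at which the objective does not depend on the quantizer\<close>

lemma qcost_infinite_moment:
  fixes \<pi> :: "'a::euclidean_space measure"
  assumes prob: "prob_space \<pi>" and sets: "sets \<pi> = sets borel" and Q: "Q \<in> Qc M"
    and inf: "(\<integral>\<^sup>+x. ennreal ((norm x)\<^sup>2) \<partial>\<pi>) = \<infinity>"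
  shows "qcost M \<pi> Q = \<infinity>"
proof -
  note [measurable_cong] = sets
  note [measurable] = Qc_cell_measurable[OF Q]
  interpret prob_space \<pi> by fact
  have Qr: "Q x \<in> {1..M}" for x using Q rangeI[of Q x] unfolding Qc_def by blast
  have "(\<Sum>i=1..M. indicator (Q -` {i}) x * ennreal ((norm x)\<^sup>2)) = ennreal ((norm x)\<^sup>2)" for x
  proof -
    have "(\<Sum>i=1..M. indicator (Q -` {i}) x * ennreal ((norm x)\<^sup>2)) = (\<Sum>i\<in>{1..M}. if i = Q x then ennreal ((norm x)\<^sup>2) else 0)"
      by (intro sum.cong) (auto simp: indicator_def)
    then show ?thesis using Qr[of x] by simp
  qed
  \<comment> \<open>The infinite second moment is a finite sum over cells, so some cell carries an
    infinite share.\<close>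
  then have "(\<Sum>i=1..M. \<integral>\<^sup>+x. indicator (Q -` {i}) x * ennreal ((norm x)\<^sup>2) \<partial>\<pi>) = \<infinity>"
    using inf by (subst nn_integral_sum[symmetric]) auto
  then obtain i where i: "i \<in> {1..M}" "(\<integral>\<^sup>+x. indicator (Q -` {i}) x * ennreal ((norm x)\<^sup>2) \<partial>\<pi>) = \<infinity>"
    by (auto simp: ennreal_sum_eq_top)
  have "(\<integral>\<^sup>+x. indicator (Q -` {i}) x * ennreal ((norm (x - u))\<^sup>2) \<partial>\<pi>) = \<infinity>" for u
  proof (rule ccontr)
    assume "\<not> ?thesis"
    then have fin: "(\<integral>\<^sup>+x. indicator (Q -` {i}) x * ennreal ((norm (x - u))\<^sup>2) \<partial>\<pi>) < \<infinity>" by (simp add: less_top)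
    \<comment> \<open>No choice of \<open>u\<close> helps: moving the center to \<open>u\<close>
      costs a factor 2 and an additive constant, whose integral is finite for a probability
      measure.\<close>
    have "(\<integral>\<^sup>+x. indicator (Q -` {i}) x * ennreal ((norm x)\<^sup>2) \<partial>\<pi>)
        \<le> (\<integral>\<^sup>+x. 2 * (indicator (Q -` {i}) x * ennreal ((norm (x - u))\<^sup>2)) + ennreal (2 * (norm u)\<^sup>2) \<partial>\<pi>)"
    proof (rule nn_integral_mono)
      fix x
      have "ennreal ((norm x)\<^sup>2) \<le> ennreal (2 * (norm (x - u))\<^sup>2 + 2 * (norm u)\<^sup>2)"
        using norm_add_sq_le[of "x - u" u] by (intro ennreal_leI) simp
      also have "\<dots> = 2 * ennreal ((norm (x - u))\<^sup>2) + ennreal (2 * (norm u)\<^sup>2)"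
        by (simp add: ennreal_mult)
      finally show "indicator (Q -` {i}) x * ennreal ((norm x)\<^sup>2)
        \<le> 2 * (indicator (Q -` {i}) x * ennreal ((norm (x - u))\<^sup>2)) + ennreal (2 * (norm u)\<^sup>2)"
        by (simp add: indicator_def)
    qed
    also have "\<dots> = 2 * (\<integral>\<^sup>+x. indicator (Q -` {i}) x * ennreal ((norm (x - u))\<^sup>2) \<partial>\<pi>) + ennreal (2 * (norm u)\<^sup>2)"
      by (subst nn_integral_add) (auto simp: nn_integral_cmult emeasure_space_1)
    also have "\<dots> < \<infinity>" using fin by (simp add: ennreal_mult_less_top)
    finally show False using i(2) by simp
  qed
  then have "(INF u. \<integral>\<^sup>+x. indicator (Q -` {i}) x * ennreal ((norm (x - u))\<^sup>2) \<partial>\<pi>) = \<infinity>" by simp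
  then show ?thesis unfolding qcost_def using i(1) by (auto simp: ennreal_sum_eq_top)
qed

text \<open>The cell containing \<open>x0\<close> has probability 1, the choice
  \<open>u = x0\<close> makes the cost 0, and conditioning on that cell changes nothing. The updated
  measure is the law of the next state from \<open>x0\<close>, for every \<open>Q\<close>.\<close>

lemma objective_return:
  assumes Q: "Q \<in> Qc M" and [measurable]: "\<And>z. (\<lambda>x. phi x z) \<in> borel_measurable borel"
  shows "objective T M phi J (return borel x0) Q = J (density lborel (\<lambda>z. ennreal (phi x0 z)))"
proof -
  note [measurable] = Qc_cell_measurable[OF Q]
  have Qr: "Q x0 \<in> {1..M}" using Q rangeI[of Q x0] unfolding Qc_def by blast
  have "(INF u. \<integral>\<^sup>+x. indicator (Q -` {i}) x * ennreal ((norm (x - u))\<^sup>2) \<partial>return borel x0) = 0" for i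
    by (rule antisym, rule INF_lower2[of x0]) (auto simp: nn_integral_return)
  then have q: "qcost M (return borel x0) Q = 0" by (simp add: qcost_def)
  have nn: "(\<integral>\<^sup>+x. indicator (Q -` {m}) x * ennreal (phi x z) \<partial>return borel x0)
      = indicator (Q -` {m}) x0 * ennreal (phi x0 z)" for m z
    by (intro nn_integral_return) auto
  have "(\<Sum>m=1..M. J (post phi m (return borel x0) Q) * emeasure (return borel x0) (Q -` {m}))
      = (\<Sum>m\<in>{1..M}. if m = Q x0 then J (density lborel (\<lambda>z. ennreal (phi x0 z))) else 0)"
    by (intro sum.cong) (auto simp: post_def nn divide_ennreal_def)
  then show ?thesis using Qr by (simp add: objective_def q)
qed

section \<open>Real densities for the given measures, and the conclusion\<close>

lemma (in sigma_finite_measure) real_density_exists: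
  assumes "finite_measure N" "absolutely_continuous M N" "sets N = sets M"
  obtains g :: "'a \<Rightarrow> real" where "g \<in> borel_measurable M" "\<And>x. 0 \<le> g x"
    "N = density M (\<lambda>x. ennreal (g x))"
proof -
  obtain D where D: "D \<in> borel_measurable M" "AE x in M. RN_deriv M N x = ennreal (D x)" "\<And>x. 0 \<le> D x"
    by (rule real_RN_deriv[OF assms]) blast
  have "N = density M (RN_deriv M N)" using density_RN_deriv[OF assms(2,3)] by simp
  also have "\<dots> = density M (\<lambda>x. ennreal (D x))"
    using D by (intro density_cong) auto
  finally show ?thesis using that D by blast
qed

lemma in_S_density:
  assumes "in_S C C1 \<pi>"
  obtains g where "\<pi> = dmeas g" "prob_space (dmeas g)" "\<And>x. 0 \<le> g x" "C1-lipschitz_on UNIV g"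
  using assms unfolding in_S_def dmeas_def by auto

theorem theorem11:
  fixes f :: "'a::euclidean_space \<Rightarrow> 'a \<Rightarrow> 'a"
    and nu_w :: "'a measure" and pi0 :: "'a measure"
    and phi :: "'a \<Rightarrow> 'a \<Rightarrow> real"
    and C C1 K :: real and M T :: nat
  assumes f_meas: "(\<lambda>(x, w). f x w) \<in> borel_measurable (borel \<Otimes>\<^sub>M borel)"
    and nu_prob: "prob_space nu_w" and nu_sets: "sets nu_w = sets borel"
    and phi_dens: "\<And>x. distr nu_w borel (f x) = density lborel (\<lambda>z. ennreal (phi x z))"
    and phi_pos: "\<And>x z. phi x z > 0"
    and phi_bdd: "\<And>x z. phi x z \<le> C"
    and phi_lip: "\<And>x. C1-lipschitz_on UNIV (phi x)"
    and pi0_prob: "prob_space pi0" and pi0_sets: "sets pi0 = sets borel"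
    and K_pos: "K > 0"
    and f_growth: "\<And>x w. norm (f x w) \<le> K * (norm x + norm w)"
    and nu_moment: "(\<integral>\<^sup>+ z. ennreal ((norm z)\<^sup>2) \<partial>nu_w) < \<infinity>"
    and pi0_cases: "(absolutely_continuous lborel pi0 \<and> (\<integral>\<^sup>+ x. ennreal ((norm x)\<^sup>2) \<partial>pi0) < \<infinity>)
                    \<or> (\<exists>x0. pi0 = return borel x0)"
    and M_pos: "M \<ge> 1"
    and T_pos: "T \<ge> 1"
  shows "(\<forall>t<T. \<forall>\<pi>. (in_S C C1 \<pi> \<or> (t = 0 \<and> \<pi> = pi0)) \<longrightarrow>
            (\<exists>Q\<in>Qc M. JT T M phi t \<pi> = objective T M phi (JT T M phi (Suc t)) \<pi> Q))
       \<and> (\<forall>t\<le>T. \<forall>\<pi>s \<pi>. (\<forall>n. in_S C C1 (\<pi>s n)) \<and> in_S C C1 \<pi> \<and> weakly_converges \<pi>s \<pi> \<and>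
            ((\<lambda>L. SUP n. \<integral>\<^sup>+ x. indicator {x. (norm x)\<^sup>2 \<ge> L} x * ennreal ((norm x)\<^sup>2) \<partial>(\<pi>s n))
               \<longlongrightarrow> 0) at_top
            \<longrightarrow> (\<lambda>n. JT T M phi t (\<pi>s n)) \<longlonglongrightarrow> JT T M phi t \<pi>)"
proof -
  interpret markov_source f nu_w phi C C1 K
    by (rule markov_source.intro[OF f_meas nu_prob nu_sets phi_dens phi_pos phi_bdd phi_lip
          K_pos f_growth nu_moment])
  have attained: "\<exists>Q\<in>Qc M. JT T M phi t \<pi> = objective T M phi (JT T M phi (Suc t)) \<pi> Q"
    if t: "t < T" and \<pi>: "in_S C C1 \<pi> \<or> (t = 0 \<and> \<pi> = pi0)" for t \<pi>
  proof -
    define J where "J = Jaux T M phi (T - Suc t)"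
    have JS: "JT T M phi (Suc t) = J" by (simp add: JT_def J_def)
    \<comment> \<open>\<open>Jaux\<close> counts remaining steps; \<open>t < T\<close> guarantees
      that one is left, so the recursive equation applies.\<close>
    have "T - t = Suc (T - Suc t)" using t by simp
    then have Jt: "JT T M phi t \<pi> = (INF Q\<in>Qc M. objective T M phi J \<pi> Q)"
      by (simp add: JT_def J_def)
    obtain b where J: "regular b J" using regular_Jaux[OF M_pos T_pos] unfolding J_def by blast
    \<comment> \<open>Prepared for the two degenerate cases, infinite second moment and point mass;
      the constant quantizer then serves as minimizer.\<close>
    have const: "\<exists>Q\<in>Qc M. (INF Q\<in>Qc M. objective T M phi J \<pi> Q) = objective T M phi J \<pi> Q"
      if "\<And>Q. Q \<in> Qc M \<Longrightarrow> objective T M phi J \<pi> Q = v" for v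
    proof -
      have "Qc M \<noteq> ({} :: ('a \<Rightarrow> nat) set)" using const_one_in_Qc[OF M_pos] by blast
      then have "(INF Q\<in>Qc M. objective T M phi J \<pi> Q) = v" using that by (rule INF_eq_const)
      with that[OF const_one_in_Qc[OF M_pos]] show ?thesis
        by (intro bexI[OF _ const_one_in_Qc[OF M_pos]]) simp
    qed
    have "\<exists>Q\<in>Qc M. (INF Q\<in>Qc M. objective T M phi J \<pi> Q) = objective T M phi J \<pi> Q"
      using \<pi>
    proof (elim disjE conjE)
      assume "in_S C C1 \<pi>"
      then obtain g where g: "\<pi> = dmeas g" "prob_space (dmeas g)" "\<And>x. 0 \<le> g x" "C1-lipschitz_on UNIV g"
        by (rule in_S_density) blast
      show ?thesis
      proof (cases "(\<integral>\<^sup>+x. ennreal ((norm x)\<^sup>2) \<partial>dmeas g) < \<infinity>")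
        case True
        from densI[OF lipschitz_borel_measurable[OF g(4)] g(3,2) this] show ?thesis
          unfolding g(1) by (rule objective_attained[OF J _ M_pos T_pos])
      next
        case False
        then have inf: "(\<integral>\<^sup>+x. ennreal ((norm x)\<^sup>2) \<partial>dmeas g) = \<infinity>" by (simp add: less_top[symmetric])
        have "qcost M \<pi> Q = \<infinity>" if "Q \<in> Qc M" for Q
          unfolding g(1) by (rule qcost_infinite_moment[OF g(2) _ that inf]) (simp add: dmeas_def)
        then show ?thesis
          by (intro const[of \<infinity>]) (simp add: objective_def ennreal_top_divide)
      qed
    next
      assume "\<pi> = pi0"
      show ?thesis
        using pi0_cases
      proof (elim disjE conjE exE)
        assume ac: "absolutely_continuous lborel pi0" and fin: "(\<integral>\<^sup>+ x. ennreal ((norm x)\<^sup>2) \<partial>pi0) < \<infinity>"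
        have "finite_measure pi0" using pi0_prob by (rule prob_space.axioms)
        then obtain g where g: "g \<in> borel_measurable lborel" "\<And>x. 0 \<le> g x" "pi0 = dmeas g"
          using lborel.real_density_exists[OF _ ac] pi0_sets unfolding dmeas_def by auto
        have "dens g" using g pi0_prob fin by (intro densI) auto
        then show ?thesis
          unfolding \<open>\<pi> = pi0\<close> g(3) by (rule objective_attained[OF J _ M_pos T_pos])
      next
        fix x0 assume "pi0 = return borel x0"
        then show ?thesis
          unfolding \<open>\<pi> = pi0\<close>[symmetric] by (intro const) (simp add: objective_return)
      qed
    qed
    then show ?thesis unfolding Jt JS .
  qed
  have cont: "(\<lambda>n. JT T M phi t (\<pi>s n)) \<longlonglongrightarrow> JT T M phi t \<pi>"
    if S: "\<And>n. in_S C C1 (\<pi>s n)" "in_S C C1 \<pi>" and weak: "weakly_converges \<pi>s \<pi>"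
      and ui: "((\<lambda>L. SUP n. \<integral>\<^sup>+ x. indicator {x. (norm x)\<^sup>2 \<ge> L} x * ennreal ((norm x)\<^sup>2) \<partial>(\<pi>s n))
               \<longlongrightarrow> 0) at_top" for t \<pi>s \<pi>
  proof -
    have "\<forall>n. \<exists>g. \<pi>s n = dmeas g \<and> prob_space (dmeas g) \<and> (\<forall>x. 0 \<le> g x) \<and> C1-lipschitz_on UNIV g"
    proof
      show "\<exists>g. \<pi>s n = dmeas g \<and> prob_space (dmeas g) \<and> (\<forall>x. 0 \<le> g x) \<and> C1-lipschitz_on UNIV g" for n
        by (rule in_S_density[OF S(1)[of n]]) blast
    qed
    from choice[OF this] obtain gs where gs: "\<And>n. \<pi>s n = dmeas (gs n)" "\<And>n. prob_space (dmeas (gs n))"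
      "\<And>n x. 0 \<le> gs n x" "\<And>n. C1-lipschitz_on UNIV (gs n)" by blast
    obtain g where g: "\<pi> = dmeas g" "prob_space (dmeas g)" "\<And>x. 0 \<le> g x" "C1-lipschitz_on UNIV g"
      using S(2) by (rule in_S_density) blast
    have \<pi>s: "\<pi>s = (\<lambda>n. dmeas (gs n))" using gs(1) by blast
    have "dconv gs g"
      using weak ui unfolding \<pi>s g(1) by (rule weakly_converges_dconv[OF gs(4) g(4) gs(3) g(3) gs(2) g(2)])
    moreover obtain b where "regular b (Jaux T M phi (T - t))" using regular_Jaux[OF M_pos T_pos] by blast
    ultimately show ?thesis unfolding JT_def \<pi>s g(1) by (auto simp: regular_def)
  qed
  show ?thesis
    by (intro conjI allI impI; (elim conjE)?) (rule attained cont; blast)+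
qed

end
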